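(* Let $\mathscr{B}\subset\mathbb{N}\setminus\{1\}$ be primitive and Besicovitch, and let $D\subset\mathcal{F}_{\mathscr{B}}$ be a set with $d(\mathcal{F}_{\mathscr{B}}\setminus D)=0$ such that for all $r\in\mathbb{N}$ the following are equivalent: (i) $r\in D$; (ii) $\mathcal{F}_{\mathscr{B}}-r$ is divisible; (iii) $\mathcal{F}_{\mathscr{B}}-r$ is an averaging set of polynomial multiple recurrence. Then $D=\mathcal{F}_{\mathscr{B}}$ if and only if $\mathscr{B}$ is taut.
   Context: $\mathbb{N}=\{1,2,3,\dots\}$. For $R\subset\mathbb{N}$, $d(R)=\lim_{N\to\infty}\frac1N|R\cap\{1,\dots,N\}|$ when the limit exists, and $\boldsymbol\delta(R)=\lim_{N\to\infty}\frac1{\log N}\sum_{n=1}^N\frac1n\mathbf{1}_R(n)$ is the logarithmic density when it exists. For $\mathscr{B}\subset\mathbb{N}\setminus\{1\}$, $\mathcal{M}_{\mathscr{B}}=\bigcup_{b\in\mathscr{B}}b\mathbb{N}$ and $\mathcal{F}_{\mathscr{B}}=\mathbb{N}\setminus\mathcal{M}_{\mathscr{B}}$. By a theorem of Davenport and Erdős, $\boldsymbol\delta(\mathcal{M}_{\mathscr{B}})$ always exists. $\mathscr{B}$ is primitive if no $b\in\mathscr{B}$ divides another $b'\in\mathscr{B}$, $b'\neq b$. $\mathscr{B}$ is Besicovitch if $d(\mathcal{M}_{\mathscr{B}})$ exists. $\mathscr{B}$ is taut if $\boldsymbol\delta(\mathcal{M}_{\mathscr{B}})>\boldsymbol\delta(\mathcal{M}_{\mathscr{B}\setminus\{b\}})$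 for every $b\in\mathscr{B}$. $\mathcal{F}_{\mathscr{B}}-r$ is regarded as the subset $\{n\in\mathbb{N}:n+r\in\mathcal{F}_{\mathscr{B}}\}$ of $\mathbb{N}$. A set $R\subset\mathbb{N}$ is divisible if $d(R\cap u\mathbb{N})$ exists and is positive for all $u\in\mathbb{N}$. Averaging set of polynomial multiple recurrence: $R\subset\mathbb{N}$ is such a set if for every invertible measure preserving system $(X,\mathcal{B},\mu,T)$ (with $\mu$ a probability measure), every $A\in\mathcal{B}$ with $\mu(A)>0$, every $\ell\in\mathbb{N}$ and all polynomials $p_i\in\mathbb{Q}[t]$, $i=1,\dots,\ell$, with $p_i(\mathbb{Z})\subset\mathbb{Z}$ and $p_i(0)=0$, the limit $$\lim_{N\to\infty}\frac{1}{|R\cap[1,N]|}\sum_{n=1}^N\mathbf{1}_R(n)\,\mu\big(A\cap T^{-p_1(n)}A\cap\dots\cap T^{-p_\ell(n)}A\big)$$ exists and is positive. *)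

theory Defs
  imports
    "HOL-Probability.Probability"
    "HOL-Computational_Algebra.Polynomial"
begin

text \<open>
  Throughout, the natural numbers of the mathematics are \<open>1, 2, 3, \<dots>\<close>, whereas the type
  \<^typ>\<open>nat\<close> contains \<open>0\<close>. Sets of naturals are of type \<^typ>\<open>nat set\<close>, and only their
  positive elements are ever counted or produced below.
\<close>

subsection \<open>Densities\<close>

definition has_density :: "nat set \<Rightarrow> real \<Rightarrow> bool" where
  "has_density R c \<longleftrightarrow> (\<lambda>N. 1 / real N * real (card (R \<inter> {1..N}))) \<longlonglongrightarrow> c"

text \<open>The value is only meaningful if the limit exists, which by the theorem of Davenport and
  Erdos is the case for all sets of multiples.\<close>

definition log_density :: "nat set \<Rightarrow> real" where
  "log_density R = lim (\<lambda>N. 1 / ln (real N) * (\<Sum>n = 1..N. 1 / real n * indicator R n))"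

subsection \<open>Sets of multiples and free numbers\<close>

definition multiples :: "nat \<Rightarrow> nat set" where
  "multiples b = {b * k | k. 1 \<le> k}"

definition mult_set :: "nat set \<Rightarrow> nat set" where
  "mult_set B = (\<Union>b\<in>B. multiples b)"

definition free_set :: "nat set \<Rightarrow> nat set" where
  "free_set B = {1..} - mult_set B"

definition primitive_set :: "nat set \<Rightarrow> bool" where
  "primitive_set B \<longleftrightarrow> (\<forall>b\<in>B. \<forall>b'\<in>B. b' \<noteq> b \<longrightarrow> \<not> b dvd b')"

definition besicovitch :: "nat set \<Rightarrow> bool" where
  "besicovitch B \<longleftrightarrow> (\<exists>c. has_density (mult_set B) c)"

definition taut :: "nat set \<Rightarrow> bool" where
  "taut B \<longleftrightarrow> (\<forall>b\<in>B. log_density (mult_set B) > log_density (mult_set (B - {b})))"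

definition shift_down :: "nat set \<Rightarrow> nat \<Rightarrow> nat set" where
  "shift_down S r = {n. 1 \<le> n \<and> n + r \<in> S}"

definition divisible_set :: "nat set \<Rightarrow> bool" where
  "divisible_set R \<longleftrightarrow> (\<forall>u\<ge>1. \<exists>c>0. has_density (R \<inter> multiples u) c)"

subsection \<open>Averaging sets of polynomial multiple recurrence\<close>

definition invertible_mps :: "'a measure \<Rightarrow> ('a \<Rightarrow> 'a) \<Rightarrow> bool" where
  "invertible_mps M T \<longleftrightarrow>
     prob_space M \<and>
     bij_betw T (space M) (space M) \<and>
     T \<in> measurable M M \<and>
     the_inv_into (space M) T \<in> measurable M M \<and>
     (\<forall>A\<in>sets M. emeasure M (T -` A \<inter> space M) = emeasure M A)"

text \<open>The set \<open>T\<^sup>-\<^sup>k A\<close> for an integer \<open>k\<close>, a forward image if \<open>k\<close> is negative.\<close>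

definition iter_preimage :: "'a measure \<Rightarrow> ('a \<Rightarrow> 'a) \<Rightarrow> int \<Rightarrow> 'a set \<Rightarrow> 'a set" where
  "iter_preimage M T k A =
     (if 0 \<le> k then (T ^^ nat k) -` A \<inter> space M else (T ^^ nat (- k)) ` A)"

definition integer_valued :: "rat poly \<Rightarrow> bool" where
  "integer_valued p \<longleftrightarrow> (\<forall>k::int. poly p (of_int k) \<in> \<int>)"

text \<open>Recurrence for all systems whose points are of type \<^typ>\<open>'a\<close>. The floor only
  converts the integer-valued \<open>p\<^sub>i(n)\<close> from type \<^typ>\<open>rat\<close> to \<^typ>\<open>int\<close>.\<close>

definition averaging_set_on :: "'a itself \<Rightarrow> nat set \<Rightarrow> bool" where
  "averaging_set_on _ R \<longleftrightarrow>
     (\<forall>(M :: 'a measure) T A (l :: nat) (p :: nat \<Rightarrow> rat poly).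
        invertible_mps M T \<longrightarrow> A \<in> sets M \<longrightarrow> measure M A > 0 \<longrightarrow> 1 \<le> l \<longrightarrow>
        (\<forall>i\<in>{1..l}. integer_valued (p i) \<and> poly (p i) 0 = 0) \<longrightarrow>
        (\<exists>L>0. (\<lambda>N. 1 / real (card (R \<inter> {1..N})) *
                 (\<Sum>n = 1..N. indicator R n *
                    measure M (A \<inter> (\<Inter>i\<in>{1..l}. iter_preimage M T \<lfloor>poly (p i) (of_nat n)\<rfloor> A))))
               \<longlonglongrightarrow> L))"

text \<open>HOL cannot quantify over types inside a formula. Nothing is lost by fixing the point type
  \<^typ>\<open>int \<Rightarrow> bool\<close>: the numbers averaged above depend only on the factor generated by \<open>A\<close>, which
  lives on the two-sided shift space, so recurrence for all systems on this type
  implies recurrence for all systems on every type (lemma \<open>averaging_set_on_any_type\<close>).\<close>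

definition averaging_set :: "nat set \<Rightarrow> bool" where
  "averaging_set R \<longleftrightarrow> averaging_set_on TYPE(int \<Rightarrow> bool) R"

subsection \<open>Independence of the point type\<close>

lemma coding_factor:
  fixes M :: "'a measure"
  assumes mps: "invertible_mps M T" and A: "A \<in> sets M"
  shows "\<exists>(N :: (int \<Rightarrow> bool) measure) U A'.
           invertible_mps N U \<and> A' \<in> sets N \<and> measure N A' = measure M A \<and>
           (\<forall>(l::nat) q. measure N (A' \<inter> (\<Inter>i\<in>{1..l}. iter_preimage N U (q i) A')) =
                         measure M (A \<inter> (\<Inter>i\<in>{1..l}. iter_preimage M T (q i) A)))"
proof -
  define S where "S = the_inv_into (space M) T"
  have prob: "prob_space M" and bij: "bij_betw T (space M) (space M)"
    and T: "T \<in> measurable M M" and S: "S \<in> measurable M M"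
    and pres: "\<And>C. C \<in> sets M \<Longrightarrow> emeasure M (T -` C \<inter> space M) = emeasure M C"
    using mps unfolding invertible_mps_def S_def by auto
  have ST: "S (T x) = x" if "x \<in> space M" for x
    using bij that unfolding S_def bij_betw_def by (simp add: the_inv_into_f_f)
  have TS: "T (S x) = x" if "x \<in> space M" for x
    using bij that unfolding S_def bij_betw_def by (simp add: f_the_inv_into_f)
  have Tn: "(T ^^ n) \<in> measurable M M" for n
    by (induction n) (auto intro: measurable_compose[OF _ T] simp: id_def)
  have Sn: "(S ^^ n) \<in> measurable M M" for n
    by (induction n) (auto intro: measurable_compose[OF _ S] simp: id_def)
  have Tsp: "T x \<in> space M" if "x \<in> space M" for x
    using measurable_space[OF T that] .
  have Tnsp: "(T ^^ n) x \<in> space M" if "x \<in> space M" for n x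
    using measurable_space[OF Tn that] .
  have Snsp: "(S ^^ n) x \<in> space M" if "x \<in> space M" for n x
    using measurable_space[OF Sn that] .
  have SnTn: "(S ^^ n) ((T ^^ n) x) = x" if "x \<in> space M" for n x
    using that
  proof (induction n)
    case (Suc n)
    have "(S ^^ Suc n) ((T ^^ Suc n) x) = (S ^^ n) (S (T ((T ^^ n) x)))"
      by (simp add: funpow_swap1)
    then show ?case using Suc ST[OF Tnsp[OF Suc.prems]] by simp
  qed simp
  have TnSn: "(T ^^ n) ((S ^^ n) x) = x" if "x \<in> space M" for n x
    using that
  proof (induction n)
    case (Suc n)
    have "(T ^^ Suc n) ((S ^^ Suc n) x) = (T ^^ n) (T (S ((S ^^ n) x)))"
      by (simp add: funpow_swap1)
    then show ?case using Suc TS[OF Snsp[OF Suc.prems]] by simp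
  qed simp
  define it where "it k x = (if 0 \<le> k then (T ^^ nat k) x else (S ^^ nat (- k)) x)" for k x
  have it_meas: "it k \<in> measurable M M" for k
    using Tn Sn unfolding it_def by (cases "0 \<le> k") auto
  have itT: "it k (T x) = it (k + 1) x" if x: "x \<in> space M" for k x
  proof (cases "0 \<le> k")
    case True
    then have "nat (k + 1) = Suc (nat k)" by simp
    then show ?thesis using True by (simp add: it_def funpow_swap1)
  next
    case False
    define m where "m = nat (- k - 1)"
    have m: "nat (- k) = Suc m" "k = - int m - 1"
      using False by (auto simp: m_def)
    have "it k (T x) = (S ^^ m) x"
      using False m(1) ST[OF x] by (simp add: it_def funpow_swap1)
    also have "\<dots> = it (k + 1) x"
    proof (cases "m = 0")
      case True
      then show ?thesis using m(2) by (simp add: it_def)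
    next
      case False
      then have "\<not> 0 \<le> k + 1" "nat (- (k + 1)) = m" using m(2) by auto
      then show ?thesis by (simp only: it_def if_False)
    qed
    finally show ?thesis .
  qed
  have pre_it: "iter_preimage M T k A = {x \<in> space M. it k x \<in> A}" for k
  proof (cases "0 \<le> k")
    case True
    then show ?thesis by (auto simp: iter_preimage_def it_def)
  next
    case False
    have sub: "A \<subseteq> space M" using A sets.sets_into_space by blast
    have "(T ^^ nat (- k)) ` A = {x \<in> space M. (S ^^ nat (- k)) x \<in> A}"
    proof (intro equalityI subsetI)
      fix y assume "y \<in> (T ^^ nat (- k)) ` A"
      then show "y \<in> {x \<in> space M. (S ^^ nat (- k)) x \<in> A}"
        using sub Tnsp SnTn by (auto simp: subset_iff)
    next
      fix y assume "y \<in> {x \<in> space M. (S ^^ nat (- k)) x \<in> A}"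
      then show "y \<in> (T ^^ nat (- k)) ` A"
        using TnSn[of y "nat (- k)"] by (metis (mono_tags, lifting) image_eqI mem_Collect_eq)
    qed
    then show ?thesis using False by (simp add: iter_preimage_def it_def)
  qed

  define P :: "(int \<Rightarrow> bool) measure" where "P = PiM UNIV (\<lambda>_. count_space UNIV)"
  define c where "c x = (\<lambda>k. it k x \<in> A)" for x
  define U :: "(int \<Rightarrow> bool) \<Rightarrow> int \<Rightarrow> bool" where "U w = (\<lambda>k. w (k + 1))" for w
  define V :: "(int \<Rightarrow> bool) \<Rightarrow> int \<Rightarrow> bool" where "V w = (\<lambda>k. w (k - 1))" for w
  define N where "N = distr M P c"
  define A' :: "(int \<Rightarrow> bool) set" where "A' = {w. w 0}"
  have spP: "space P = UNIV" by (simp add: P_def space_PiM)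
  have spN: "space N = UNIV" and sN: "sets N = sets P" by (simp_all add: N_def spP)
  have coord: "(\<lambda>w. w k) \<in> measurable P (count_space UNIV)" for k
    unfolding P_def by (rule measurable_component_singleton) simp
  have measP: "f \<in> measurable L P"
    if "\<And>k. (\<lambda>x. f x k) \<in> measurable L (count_space UNIV)" for f :: "'b \<Rightarrow> int \<Rightarrow> bool" and L
    unfolding P_def by (rule measurable_PiM_single') (use that in auto)
  have c: "c \<in> measurable M P"
  proof (rule measP)
    fix k
    have "Measurable.pred M (\<lambda>x. it k x \<in> A)"
      using measurable_sets[OF it_meas A, of k] by (auto simp: pred_def vimage_def Int_def conj_commute)
    then show "(\<lambda>x. c x k) \<in> measurable M (count_space UNIV)" by (simp add: c_def)
  qed
  have UP: "U \<in> measurable P P" and VP: "V \<in> measurable P P"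
    by (rule measP, simp add: U_def V_def coord)+
  have bijU: "bij_betw U UNIV UNIV"
    by (rule bij_betw_byWitness[of _ V]) (auto simp: U_def V_def)
  have invUV: "the_inv_into UNIV U = V"
  proof (rule ext, rule the_inv_into_f_eq)
    show "inj U" using bijU by (simp add: bij_betw_def)
  qed (auto simp: U_def V_def)
  have cT: "c (T x) = U (c x)" if "x \<in> space M" for x
    using itT[OF that] by (simp add: c_def U_def)
  have presU: "emeasure N (U -` C \<inter> space N) = emeasure N C" if C: "C \<in> sets N" for C
  proof -
    have CP: "C \<in> sets P" and UC: "U -` C \<in> sets P"
      using C measurable_sets[OF UP, of C] by (auto simp: sN spP)
    have "emeasure N (U -` C \<inter> space N) = emeasure M (c -` (U -` C) \<inter> space M)"
      unfolding N_def using UC c by (simp add: emeasure_distr spP)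
    also have "c -` (U -` C) \<inter> space M = T -` (c -` C \<inter> space M) \<inter> space M"
      using cT Tsp by auto
    also have "emeasure M \<dots> = emeasure M (c -` C \<inter> space M)"
      using measurable_sets[OF c CP] by (rule pres)
    also have "\<dots> = emeasure N C"
      unfolding N_def using CP c by (simp add: emeasure_distr)
    finally show ?thesis .
  qed
  have mpsN: "invertible_mps N U"
    unfolding invertible_mps_def
  proof (intro conjI ballI)
    show "prob_space N" unfolding N_def using prob c by (rule prob_space.prob_space_distr)
    show "U \<in> measurable N N" "the_inv_into (space N) U \<in> measurable N N"
      using UP VP measurable_cong_sets[OF sN sN] by (simp_all add: spN invUV)
  qed (use bijU presU in \<open>simp_all add: spN\<close>)
  have Un: "(U ^^ n) w = (\<lambda>k. w (k + int n))" for n w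
    by (induction n arbitrary: w) (auto simp: U_def algebra_simps fun_eq_iff)
  have preU: "iter_preimage N U k A' = {w. w k}" for k
  proof (cases "0 \<le> k")
    case True
    then show ?thesis by (auto simp: iter_preimage_def spN Un A'_def)
  next
    case False
    have "w \<in> (U ^^ nat (- k)) ` A'" if "w k" for w
      by (rule image_eqI[of _ _ "\<lambda>j. w (j + k)"]) (use False that in \<open>auto simp: Un A'_def\<close>)
    moreover have "w k" if w: "w \<in> (U ^^ nat (- k)) ` A'" for w
    proof -
      obtain v where v: "v \<in> A'" "w = (U ^^ nat (- k)) v" using w by blast
      have "k + int (nat (- k)) = 0" using False by simp
      then show ?thesis using v by (simp only: Un A'_def mem_Collect_eq)
    qed
    ultimately show ?thesis using False unfolding iter_preimage_def by auto
  qed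
  have cyl: "{w. w k} \<in> sets P" for k
    using measurable_sets[OF coord, of "{True}" k] by (simp add: spP vimage_def)
  have A'P: "A' \<in> sets P" using cyl[of 0] by (simp add: A'_def)
  have measN: "measure N C = measure M (c -` C \<inter> space M)" if "C \<in> sets P" for C
    unfolding N_def using c that by (rule measure_distr)
  have subA: "A \<subseteq> space M" using A sets.sets_into_space by blast
  have it0: "it 0 x = x" for x by (simp add: it_def)
  have cA': "c -` A' \<inter> space M = A"
    using subA by (auto simp: c_def A'_def it_def)
  have "measure N (A' \<inter> (\<Inter>i\<in>{1..l}. iter_preimage N U (q i) A')) =
        measure M (A \<inter> (\<Inter>i\<in>{1..l}. iter_preimage M T (q i) A))" for l :: nat and q
  proof -
    have "A' \<inter> (\<Inter>i\<in>{1..l}. {w. w (q i)}) \<in> sets P"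
      by (cases "l = 0") (use A'P cyl in \<open>auto intro!: sets.Int sets.finite_INT\<close>)
    then have "measure N (A' \<inter> (\<Inter>i\<in>{1..l}. iter_preimage N U (q i) A')) =
        measure M (c -` (A' \<inter> (\<Inter>i\<in>{1..l}. {w. w (q i)})) \<inter> space M)"
      by (simp add: preU measN)
    also have "c -` (A' \<inter> (\<Inter>i\<in>{1..l}. {w. w (q i)})) \<inter> space M =
        A \<inter> (\<Inter>i\<in>{1..l}. iter_preimage M T (q i) A)"
      unfolding pre_it using subA by (auto simp: c_def A'_def it0)
    finally show ?thesis .
  qed
  moreover have "measure N A' = measure M A" using measN[OF A'P] cA' by simp
  ultimately show ?thesis using mpsN A'P sN by blast
qed

lemma averaging_set_on_any_type:
  assumes "averaging_set R"
  shows "averaging_set_on TYPE('a) R"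
  unfolding averaging_set_on_def
proof (intro allI impI)
  fix M :: "'a measure" and T A and l :: nat and p :: "nat \<Rightarrow> rat poly"
  assume mps: "invertible_mps M T" and A: "A \<in> sets M" and pos: "measure M A > 0" and l: "1 \<le> l"
    and p: "\<forall>i\<in>{1..l}. integer_valued (p i) \<and> poly (p i) 0 = 0"
  obtain N :: "(int \<Rightarrow> bool) measure" and U A' where
    N: "invertible_mps N U" "A' \<in> sets N" "measure N A' = measure M A"
    and eq: "\<And>(l::nat) q. measure N (A' \<inter> (\<Inter>i\<in>{1..l}. iter_preimage N U (q i) A')) =
                   measure M (A \<inter> (\<Inter>i\<in>{1..l}. iter_preimage M T (q i) A))"
    using coding_factor[OF mps A] by blast
  show "\<exists>L>0. (\<lambda>N. 1 / real (card (R \<inter> {1..N})) *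
                 (\<Sum>n = 1..N. indicator R n *
                    measure M (A \<inter> (\<Inter>i\<in>{1..l}. iter_preimage M T \<lfloor>poly (p i) (of_nat n)\<rfloor> A))))
               \<longlonglongrightarrow> L"
    using assms[unfolded averaging_set_def averaging_set_on_def, rule_format, OF N(1,2) _ l] p pos N(3)
    unfolding eq by simp
qed

end

theory Submission
  imports Defs "HOL-Number_Theory.Cong"
begin

text \<open>
  Write \<open>F\<^sub>B\<close> for \<^term>\<open>free_set B\<close>, and \<open>Q\<close> for the set of all \<open>b / gcd(b, r)\<close> with \<open>b \<in> B\<close>. Since
  \<open>b\<close> divides \<open>r n\<close> iff \<open>b / gcd(b, r)\<close> divides \<open>n\<close>, the elements of \<open>F\<^sub>B\<close> divisible by \<open>r\<close> are exactly
  \<open>r F\<^sub>Q\<close>. Both sides of the equivalence reduce to the positivity of the logarithmic density of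
  \<open>F\<^sub>Q\<close>: a free number \<open>r\<close> lies in \<open>D\<close> iff \<open>F\<^sub>Q\<close> has positive density for this \<open>r\<close>, and \<open>B\<close> is
  taut iff this is so for every free number \<open>r\<close>.

  Everything rests on one correlation inequality (\<open>finite_free_set_correlation\<close>): for a finite
  divisor-closed set \<open>E\<close> and a finite set \<open>A\<close>, the weights \<open>1/n\<close> of the elements of \<open>E\<close> that are
  free of \<open>A\<close> sum to at least \<open>d(F\<^sub>A)\<close> times the sum of all weights of \<open>E\<close>. Taking for \<open>E\<close> an
  initial segment bounds the logarithmic averages of \<open>F\<^sub>A\<close> from below, also for infinite \<open>A\<close>, by the
  infimum of the densities of finite truncations; the upper bound is trivial, and this is the
  theorem of Davenport and Erdos (\<open>davenport_erdos\<close>). Taking for \<open>E\<close> an initial segment of another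
  free set gives Behrend's inequality \<open>\<delta>(F\<^sub>A \<inter> F\<^sub>A\<^sub>') \<ge> \<delta>(F\<^sub>A) \<delta>(F\<^sub>A\<^sub>')\<close> (\<open>behrend_inequality\<close>).

  Tautness: removing \<open>b\<close> from \<open>B\<close> changes the density of the multiples by that of
  \<open>b F\<^sub>Q\<close> with \<open>Q\<close> formed from \<open>B - {b}\<close> and \<open>r = b\<close>. Split \<open>Q\<close> according to the value \<open>d\<close> of the gcd.
  By Behrend's inequality, if \<open>F\<^sub>Q\<close> is null, then so is \<open>F\<^sub>A\<close> for one of the finitely many parts \<open>A\<close>,
  and here \<open>d A \<subseteq> B\<close>. Primitivity makes this \<open>d\<close> free, and \<open>F\<^sub>B\<close> is then null along the multiples of
  \<open>d\<close>. Conversely, if \<open>F\<^sub>Q\<close> is null for a free number \<open>r\<close>, then again \<open>d A \<subseteq> B\<close> with \<open>F\<^sub>A\<close> null, and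
  \<open>F\<^sub>A\<close> remains null when one element \<open>a > 1\<close> is removed from \<open>A\<close>, so that \<open>d a\<close> can be removed from
  \<open>B\<close> without changing the density.

  Divisibility: for a Besicovitch set \<open>B\<close>, the sets \<open>F\<^sub>K\<close> belonging to the finite truncations of
  \<open>B\<close> exceed \<open>F\<^sub>B\<close> by sets whose natural density tends to \<open>0\<close>. Hence \<open>F\<^sub>B\<close> has a natural density
  along every progression \<open>r + u\<nat>\<close>, the limit of the densities for the periodic sets \<open>F\<^sub>K\<close>. Among
  the elements of the progression are the numbers \<open>r t\<close> with \<open>t \<equiv> 1 (mod u)\<close>; such a \<open>t\<close> is coprime to
  \<open>u\<close>, so only the elements of \<open>Q\<close> coprime to \<open>u\<close> matter, and freeness from those is
  independent of the residue modulo \<open>u\<close>. This gives the lower bound \<open>\<delta>(F\<^sub>Q) / (r u)\<close>, uniformly in the truncation.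
\<close>

section \<open>Natural density\<close>

lemma has_density_iff:
  "has_density R c \<longleftrightarrow> (\<lambda>N. real (card (R \<inter> {1..N})) / real N) \<longlonglongrightarrow> c"
  unfolding has_density_def by simp

lemma has_density_unique: "has_density R c \<Longrightarrow> has_density R c' \<Longrightarrow> c = c'"
  unfolding has_density_def by (rule LIMSEQ_unique)

lemma has_density_mono:
  assumes "has_density R c" "has_density R' c'" "R \<subseteq> R'"
  shows "c \<le> c'"
proof (rule LIMSEQ_le[OF assms(1)[unfolded has_density_iff] assms(2)[unfolded has_density_iff]])
  show "\<exists>N. \<forall>n\<ge>N. real (card (R \<inter> {1..n})) / real n \<le> real (card (R' \<inter> {1..n})) / real n"
    using assms(3) by (intro exI[of _ 0] allI impI divide_right_mono of_nat_mono card_mono) auto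
qed

lemma has_density_empty: "has_density {} 0"
  unfolding has_density_iff by simp

lemma has_density_nonneg: "has_density R c \<Longrightarrow> 0 \<le> c"
  using has_density_mono[OF has_density_empty] by blast

lemma has_density_positive: "has_density {1..} 1"
  unfolding has_density_iff
proof (rule tendsto_eventually)
  have "{1..} \<inter> {1..N} = {1..N}" for N :: nat by auto
  then show "\<forall>\<^sub>F N in sequentially. real (card ({1..} \<inter> {1..N})) / real N = 1"
    by (auto intro!: eventually_sequentiallyI[of 1])
qed

lemma has_density_Un:
  assumes "has_density R c" "has_density R' c'" "R \<inter> R' = {}"
  shows "has_density (R \<union> R') (c + c')"
proof -
  have "card ((R \<union> R') \<inter> {1..N}) = card (R \<inter> {1..N}) + card (R' \<inter> {1..N})" for N
    using assms(3) by (subst card_Un_disjoint[symmetric]) (auto simp: Int_Un_distrib2)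
  then show ?thesis
    using tendsto_add[OF assms(1)[unfolded has_density_iff] assms(2)[unfolded has_density_iff]]
    unfolding has_density_iff by (simp add: add_divide_distrib)
qed

lemma has_density_Diff:
  assumes "has_density R c" "has_density R' c'" "R \<subseteq> R'"
  shows "has_density (R' - R) (c' - c)"
proof -
  have "R' \<inter> {1..N} = R \<inter> {1..N} \<union> (R' - R) \<inter> {1..N}" for N
    using assms(3) by auto
  then have "card (R' \<inter> {1..N}) = card (R \<inter> {1..N}) + card ((R' - R) \<inter> {1..N})" for N
    using card_Un_disjoint[of "R \<inter> {1..N}" "(R' - R) \<inter> {1..N}" for N] by auto
  then have "real (card ((R' - R) \<inter> {1..N})) / real N
      = real (card (R' \<inter> {1..N})) / real N - real (card (R \<inter> {1..N})) / real N" for N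
    by (simp add: add_divide_distrib)
  then show ?thesis
    using tendsto_diff[OF assms(2)[unfolded has_density_iff] assms(1)[unfolded has_density_iff]]
    unfolding has_density_iff by simp
qed

lemma has_densityI_bounded_error:
  assumes "\<And>N. \<bar>real (card (R \<inter> {1..N})) - f N\<bar> \<le> C" "(\<lambda>N. f N / real N) \<longlonglongrightarrow> c"
  shows "has_density R c"
proof -
  have "(\<lambda>N. (real (card (R \<inter> {1..N})) - f N) / real N) \<longlonglongrightarrow> 0"
  proof (rule Lim_null_comparison)
    show "\<forall>\<^sub>F N in sequentially.
        norm ((real (card (R \<inter> {1..N})) - f N) / real N) \<le> C / real N"
      using assms(1) by (auto intro!: always_eventually divide_right_mono simp: abs_divide)
    show "(\<lambda>N. C / real N) \<longlonglongrightarrow> 0" by (rule lim_const_over_n)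
  qed
  from tendsto_add[OF this assms(2)] show ?thesis
    unfolding has_density_iff by (simp add: diff_divide_distrib)
qed

lemma has_density_shift_down: "has_density (shift_down R r) c \<longleftrightarrow> has_density R c"
proof -
  have c1: "card (shift_down R r \<inter> {1..N}) = card (R \<inter> {r+1..N+r})" for N
    by (rule bij_betw_same_card[of "\<lambda>n. n + r"], rule bij_betw_byWitness[of _ "\<lambda>n. n - r"])
      (auto simp: shift_down_def)
  have err: "\<bar>real (card (R \<inter> {1..N})) - real (card (R \<inter> {r+1..N+r}))\<bar> \<le> real (2 * r)" for N
  proof -
    have "card (R \<inter> {1..N}) \<le> card (R \<inter> {r+1..N+r} \<union> {1..r})"
      by (rule card_mono) auto
    also have "\<dots> \<le> card (R \<inter> {r+1..N+r}) + r"
      by (rule order_trans[OF card_Un_le]) simp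
    finally have 1: "card (R \<inter> {1..N}) \<le> card (R \<inter> {r+1..N+r}) + r" .
    have "card (R \<inter> {r+1..N+r}) \<le> card (R \<inter> {1..N} \<union> {N+1..N+r})"
      by (rule card_mono) auto
    also have "\<dots> \<le> card (R \<inter> {1..N}) + r"
      by (rule order_trans[OF card_Un_le]) simp
    finally show ?thesis using 1 by linarith
  qed
  show ?thesis
  proof
    assume "has_density (shift_down R r) c"
    then show "has_density R c"
      unfolding has_density_iff c1 by (intro has_densityI_bounded_error[OF err, unfolded has_density_iff])
  next
    assume "has_density R c"
    then show "has_density (shift_down R r) c"
      unfolding has_density_iff[of R]
      by (intro has_densityI_bounded_error[of _ "\<lambda>N. real (card (R \<inter> {1..N}))" "real (2*r)"])
        (use err in \<open>simp_all only: c1 abs_minus_commute\<close>)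
  qed
qed

lemma has_density_scale:
  assumes "has_density R c" "1 \<le> r"
  shows "has_density ((*) r ` R) (c / real r)"
proof -
  have c1: "card ((*) r ` R \<inter> {1..N}) = card (R \<inter> {1..N div r})" for N
  proof (rule bij_betw_same_card[symmetric, of "(*) r"])
    show "bij_betw ((*) r) (R \<inter> {1..N div r}) ((*) r ` R \<inter> {1..N})"
      using assms(2) unfolding bij_betw_def
      by (auto simp: inj_on_def less_eq_div_iff_mult_less_eq mult.commute)
  qed
  have lim: "filterlim (\<lambda>N. N div r) sequentially sequentially"
    unfolding filterlim_at_top
  proof (intro allI eventually_sequentiallyI)
    fix Z N :: nat assume "Z * r \<le> N"
    then show "Z \<le> N div r" using assms(2) by (simp add: less_eq_div_iff_mult_less_eq)
  qed
  have quot: "(\<lambda>N. real (N div r) / real N) \<longlonglongrightarrow> 1 / real r"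
  proof -
    have "\<bar>real (N div r) - real N / real r\<bar> \<le> 1" for N
    proof -
      have "real N = real r * real (N div r) + real (N mod r)"
        by (metis mult_div_mod_eq of_nat_add of_nat_mult)
      moreover have "real (N mod r) \<le> real r" using assms(2) by (simp add: less_imp_le)
      ultimately show ?thesis using assms(2) by (simp add: field_simps abs_if)
    qed
    have "(\<lambda>N. (real (N div r) - real N / real r) / real N) \<longlonglongrightarrow> 0"
    proof (rule Lim_null_comparison)
      show "\<forall>\<^sub>F N in sequentially.
          norm ((real (N div r) - real N / real r) / real N) \<le> 1 / real N"
        using \<open>\<And>N. \<bar>real (N div r) - real N / real r\<bar> \<le> 1\<close>
        by (auto intro!: always_eventually divide_right_mono simp: abs_divide)
      show "(\<lambda>N. 1 / real N) \<longlonglongrightarrow> 0" by (rule lim_const_over_n)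
    qed
    moreover have "(\<lambda>N. real N / real r / real N) \<longlonglongrightarrow> 1 / real r"
      by (rule tendsto_eventually, rule eventually_sequentiallyI[of 1]) simp
    ultimately show ?thesis
      using tendsto_add by (fastforce simp: diff_divide_distrib)
  qed
  have "(\<lambda>N. real (card (R \<inter> {1..N div r})) / real (N div r) * (real (N div r) / real N))
      \<longlonglongrightarrow> c * (1 / real r)"
    using filterlim_compose[OF assms(1)[unfolded has_density_iff] lim] quot by (rule tendsto_mult)
  moreover have "real (card (R \<inter> {1..N div r})) / real (N div r) * (real (N div r) / real N)
      = real (card (R \<inter> {1..N div r})) / real N" for N
    by (cases "N div r = 0") auto
  ultimately show ?thesis unfolding has_density_iff c1 by (simp only: mult_1_right times_divide_eq_right)
qed

lemma periodic_has_density: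
  assumes q: "1 \<le> q" and per: "\<And>n. 1 \<le> n \<Longrightarrow> n + q \<in> R \<longleftrightarrow> n \<in> R"
  shows "\<exists>c. has_density R c"
proof -
  \<comment> \<open>Every window of length \<open>q\<close> contains the same number \<open>k\<close> of elements.\<close>
  define k where "k = card (R \<inter> {1..q})"
  have shift: "card (R \<inter> {N+1..N+q}) = k" for N
  proof (induction N)
    case (Suc N)
    define I where "I = R \<inter> {N+2..N+q}"
    have "R \<inter> {N+1..N+q} = (if N+1 \<in> R then insert (N+1) I else I)"
      using q unfolding I_def by auto (metis Suc_leI le_neq_implies_less)+
    moreover have "R \<inter> {Suc N+1..Suc N+q} = (if N+1 \<in> R then insert (N+1+q) I else I)"
      using per[of "N+1"] q unfolding I_def
      by (auto simp: le_Suc_eq simp del: One_nat_def) auto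
    moreover have "finite I" "N+1 \<notin> I" "N+1+q \<notin> I" by (auto simp: I_def)
    ultimately show ?case using Suc by auto
  qed (simp add: k_def)
  have mult: "card (R \<inter> {1..m * q}) = m * k" for m
  proof (induction m)
    case (Suc m)
    have "R \<inter> {1..Suc m * q} = R \<inter> {1..m*q} \<union> R \<inter> {m*q+1..m*q+q}" by auto
    then have "card (R \<inter> {1..Suc m * q}) = card (R \<inter> {1..m*q}) + card (R \<inter> {m*q+1..m*q+q})"
      by (simp only:) (rule card_Un_disjoint, auto)
    then show ?case using Suc shift[of "m*q"] by simp
  qed simp
  have kq: "k \<le> q" unfolding k_def using card_mono[of "{1..q}" "R \<inter> {1..q}"] by simp
  have "has_density R (real k / real q)"
  proof (rule has_densityI_bounded_error)
    fix N
    define m where "m = N div q"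
    have N: "real N = real m * real q + real (N mod q)"
      unfolding m_def by (metis div_mult_mod_eq of_nat_add of_nat_mult)
    have lt: "N mod q < q" using q by simp
    have "card (R \<inter> {1..N}) \<le> card (R \<inter> {1..m*q} \<union> {m*q+1..m*q+N mod q})"
      by (rule card_mono) (auto simp: m_def)
    also have "\<dots> \<le> m * k + N mod q"
      by (rule order_trans[OF card_Un_le]) (simp only: mult, simp)
    finally have 1: "card (R \<inter> {1..N}) \<le> m * k + q" using lt by simp
    have "m * q \<le> N" by (simp add: m_def)
    then have "card (R \<inter> {1..m*q}) \<le> card (R \<inter> {1..N})" by (intro card_mono) auto
    then have 2: "m * k \<le> card (R \<inter> {1..N})" by (simp only: mult)
    have f: "real k * real N / real q = real (m * k) + real k * real (N mod q) / real q"
      using q by (simp add: N field_simps)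
    have "real k * real (N mod q) / real q \<le> real k * real q / real q"
      using lt by (intro divide_right_mono mult_left_mono) auto
    then have "real k * real (N mod q) / real q \<le> real q"
      using q kq by simp
    moreover have "0 \<le> real k * real (N mod q) / real q" by simp
    ultimately show "\<bar>real (card (R \<inter> {1..N})) - real k * real N / real q\<bar> \<le> real q"
      using 1 2 unfolding f by linarith
  next
    show "(\<lambda>N. real k * real N / real q / real N) \<longlonglongrightarrow> real k / real q"
      by (rule tendsto_eventually, rule eventually_sequentiallyI[of 1]) simp
  qed
  then show ?thesis ..
qed

section \<open>Logarithmic density\<close>

definition recip_sum :: "nat set \<Rightarrow> real" where
  "recip_sum E = (\<Sum>n\<in>E. 1 / real n)"

definition has_log_density :: "nat set \<Rightarrow> real \<Rightarrow> bool" where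
  "has_log_density R c \<longleftrightarrow> (\<lambda>N. recip_sum (R \<inter> {1..N}) / ln (real N)) \<longlonglongrightarrow> c"

lemma recip_sum_mono: "finite E' \<Longrightarrow> E \<subseteq> E' \<Longrightarrow> recip_sum E \<le> recip_sum E'"
  unfolding recip_sum_def by (rule sum_mono2) auto

lemma recip_sum_nonneg: "0 \<le> recip_sum E"
  unfolding recip_sum_def by (rule sum_nonneg) auto

lemma recip_sum_Un:
  "finite E \<Longrightarrow> finite E' \<Longrightarrow> E \<inter> E' = {} \<Longrightarrow> recip_sum (E \<union> E') = recip_sum E + recip_sum E'"
  unfolding recip_sum_def by (rule sum.union_disjoint)

lemma recip_sum_scale: "1 \<le> r \<Longrightarrow> recip_sum ((*) r ` E) = recip_sum E / real r"
  unfolding recip_sum_def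
  by (subst sum.reindex) (auto simp: inj_on_def sum_divide_distrib mult.commute)

lemma has_log_density_log_density:
  assumes "has_log_density R c" shows "log_density R = c"
proof -
  have "(\<Sum>n = 1..N. 1 / real n * indicator R n) = recip_sum (R \<inter> {1..N})" for N
    unfolding recip_sum_def Int_commute[of R]
    by (subst sum.inter_restrict) (auto simp: indicator_def intro!: sum.cong)
  then show ?thesis
    using assms unfolding log_density_def has_log_density_def by (auto intro!: limI)
qed

lemma has_log_density_unique: "has_log_density R c \<Longrightarrow> has_log_density R c' \<Longrightarrow> c = c'"
  unfolding has_log_density_def by (rule LIMSEQ_unique)

lemma ln_pos_eventually: "\<forall>\<^sub>F N in sequentially. 0 < ln (real N)"
  by (rule eventually_sequentiallyI[of 2]) simp

lemma has_log_density_mono: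
  assumes "has_log_density R c" "has_log_density R' c'" "R \<subseteq> R'"
  shows "c \<le> c'"
proof (rule tendsto_le[OF _ assms(2)[unfolded has_log_density_def] assms(1)[unfolded has_log_density_def]])
  show "\<forall>\<^sub>F N in sequentially.
      recip_sum (R \<inter> {1..N}) / ln (real N) \<le> recip_sum (R' \<inter> {1..N}) / ln (real N)"
    using ln_pos_eventually
    by eventually_elim (use assms(3) in \<open>auto intro!: divide_right_mono recip_sum_mono\<close>)
qed simp

lemma has_log_density_Diff:
  assumes "has_log_density R c" "has_log_density R' c'" "R \<subseteq> R'"
  shows "has_log_density (R' - R) (c' - c)"
proof -
  have "R' \<inter> {1..N} = R \<inter> {1..N} \<union> (R' - R) \<inter> {1..N}" for N
    using assms(3) by auto
  then have "recip_sum (R' \<inter> {1..N}) = recip_sum (R \<inter> {1..N}) + recip_sum ((R' - R) \<inter> {1..N})" for N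
    using recip_sum_Un[of "R \<inter> {1..N}" "(R' - R) \<inter> {1..N}"] by auto
  then have "recip_sum ((R' - R) \<inter> {1..N}) / ln (real N)
      = recip_sum (R' \<inter> {1..N}) / ln (real N) - recip_sum (R \<inter> {1..N}) / ln (real N)" for N
    by (simp add: add_divide_distrib)
  then show ?thesis
    using tendsto_diff[OF assms(2)[unfolded has_log_density_def] assms(1)[unfolded has_log_density_def]]
    unfolding has_log_density_def by simp
qed

lemma const_over_ln: "(\<lambda>N. C / ln (real N)) \<longlonglongrightarrow> 0"
  by (intro tendsto_divide_0[OF tendsto_const] filterlim_at_top_imp_at_infinity
      filterlim_compose[OF ln_at_top filterlim_real_sequentially])

text \<open>The average for \<open>r R\<close> up to \<open>N\<close> runs over \<open>R\<close> up to \<open>N div r\<close>. The reciprocals between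
  \<open>N div r\<close> and \<open>N\<close> have a bounded sum, which the factor \<open>1 / ln N\<close> removes.\<close>

lemma has_log_density_scale:
  assumes "has_log_density R c" "1 \<le> r"
  shows "has_log_density ((*) r ` R) (c / real r)"
proof -
  have img: "(*) r ` R \<inter> {1..N} = (*) r ` (R \<inter> {1..N div r})" for N
    using assms(2) by (auto simp: less_eq_div_iff_mult_less_eq mult.commute)
  have tail: "recip_sum (R \<inter> {N div r + 1..N}) \<le> real r" for N
  proof -
    define m where "m = N div r + 1"
    have "m \<noteq> 0" by (simp add: m_def)
    have lt: "N < r * m" using assms(2) unfolding m_def
      by (metis Suc_eq_plus1 dividend_less_times_div less_le_trans mult_Suc_right add.commute zero_less_one)
    have "recip_sum (R \<inter> {m..N}) \<le> recip_sum {m..N}" by (rule recip_sum_mono) auto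
    also have "\<dots> \<le> (\<Sum>n\<in>{m..N}. 1 / real m)"
      unfolding recip_sum_def by (rule sum_mono) (auto simp: m_def intro!: divide_left_mono)
    also have "\<dots> = real (card {m..N}) / real m" by simp
    also have "\<dots> \<le> real (r * m) / real m"
      using lt by (intro divide_right_mono of_nat_mono) (auto simp: m_def)
    also have "\<dots> = real r" using \<open>m \<noteq> 0\<close> by simp
    finally show ?thesis unfolding m_def .
  qed
  have split: "recip_sum (R \<inter> {1..N}) = recip_sum (R \<inter> {1..N div r}) + recip_sum (R \<inter> {N div r + 1..N})" for N
  proof -
    have "N div r \<le> N" by simp
    then have "R \<inter> {1..N} = R \<inter> {1..N div r} \<union> R \<inter> {N div r + 1..N}"
      by (auto simp del: div_le_dividend)
    then show ?thesis by (simp only:) (rule recip_sum_Un, auto)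
  qed
  have "(\<lambda>N. recip_sum (R \<inter> {N div r + 1..N}) / ln (real N)) \<longlonglongrightarrow> 0"
  proof (rule Lim_null_comparison[OF _ const_over_ln[of "real r"]])
    show "\<forall>\<^sub>F N in sequentially.
        norm (recip_sum (R \<inter> {N div r + 1..N}) / ln (real N)) \<le> real r / ln (real N)"
      using ln_pos_eventually
      by eventually_elim (use tail in \<open>auto simp: recip_sum_nonneg abs_divide intro!: divide_right_mono\<close>)
  qed
  note lim = tendsto_diff[OF assms(1)[unfolded has_log_density_def] this]
  have "(\<lambda>N. recip_sum (R \<inter> {1..N div r}) / ln (real N)) \<longlonglongrightarrow> c"
  proof (rule Lim_transform_eventually[OF lim[unfolded diff_0_right] always_eventually], intro allI)
    show "recip_sum (R \<inter> {1..N}) / ln (real N) - recip_sum (R \<inter> {N div r + 1..N}) / ln (real N)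
        = recip_sum (R \<inter> {1..N div r}) / ln (real N)" for N
      by (subst split[of N]) (simp add: add_divide_distrib)
  qed
  from tendsto_divide[OF this tendsto_const[of "real r"]] show ?thesis
    using assms(2) unfolding has_log_density_def img recip_sum_scale[OF assms(2)]
    by (simp add: mult.commute)
qed

lemma has_log_density_positive: "has_log_density {1..} 1"
proof -
  have "(\<lambda>N. (harm N - ln (real N)) / ln (real N)) \<longlonglongrightarrow> 0"
    by (intro tendsto_divide_0[OF euler_mascheroni_LIMSEQ] filterlim_at_top_imp_at_infinity
        filterlim_compose[OF ln_at_top filterlim_real_sequentially])
  from tendsto_add[OF this tendsto_const[of 1]]
  have lim: "(\<lambda>N. (harm N - ln (real N)) / ln (real N) + 1) \<longlonglongrightarrow> 1" by simp
  have "\<forall>\<^sub>F N in sequentially. (harm N - ln (real N)) / ln (real N) + 1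
      = recip_sum ({1..} \<inter> {1..N}) / ln (real N)"
    using ln_pos_eventually
  proof eventually_elim
    case (elim N)
    have "{1..} \<inter> {1..N} = {1..N}" by auto
    then show ?case using elim by (simp add: recip_sum_def harm_def inverse_eq_divide field_simps)
  qed
  from Lim_transform_eventually[OF lim this] show ?thesis unfolding has_log_density_def .
qed

lemma log_average_tendsto_0:
  fixes x :: "nat \<Rightarrow> real"
  assumes "x \<longlonglongrightarrow> 0"
  shows "(\<lambda>N. (\<Sum>n=1..N. x n / real n) / ln (real N)) \<longlonglongrightarrow> 0"
proof (rule LIMSEQ_I)
  fix e :: real assume e: "0 < e"
  obtain n0 where n0: "\<And>n. n \<ge> n0 \<Longrightarrow> \<bar>x n\<bar> < e / 2"
    using LIMSEQ_D[OF assms, of "e/2"] e by auto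
  define C where "C = (\<Sum>n=1..n0. \<bar>x n\<bar> / real n)"
  have bound: "\<bar>\<Sum>n=1..N. x n / real n\<bar> \<le> C + e / 2 * recip_sum ({1..} \<inter> {1..N})" for N
  proof -
    have "\<bar>\<Sum>n=1..N. x n / real n\<bar> \<le> (\<Sum>n=1..N. \<bar>x n\<bar> / real n)"
      by (rule order_trans[OF sum_abs]) (simp add: abs_divide)
    also have "\<dots> \<le> (\<Sum>n=1..N. (if n \<le> n0 then \<bar>x n\<bar> / real n else 0) + e / 2 * (1 / real n))"
    proof (rule sum_mono)
      fix n assume "n \<in> {1..N}"
      show "\<bar>x n\<bar> / real n \<le> (if n \<le> n0 then \<bar>x n\<bar> / real n else 0) + e / 2 * (1 / real n)"
        using n0[of n] e by (auto simp: field_simps)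
    qed
    also have "\<dots> = (\<Sum>n=1..N. (if n \<le> n0 then \<bar>x n\<bar> / real n else 0))
        + e / 2 * recip_sum ({1..} \<inter> {1..N})"
      unfolding sum.distrib recip_sum_def sum_distrib_left
      by (intro arg_cong2[of _ _ _ _ "(+)"] sum.cong) auto
    also have "(\<Sum>n=1..N. (if n \<le> n0 then \<bar>x n\<bar> / real n else 0)) = (\<Sum>n\<in>{1..N} \<inter> {..n0}. \<bar>x n\<bar> / real n)"
      by (subst sum.inter_restrict) auto
    also have "\<dots> \<le> C" unfolding C_def by (rule sum_mono2) auto
    finally show ?thesis by simp
  qed
  have "(\<lambda>N. C / ln (real N) + e / 2 * (recip_sum ({1..} \<inter> {1..N}) / ln (real N))) \<longlonglongrightarrow> 0 + e / 2 * 1"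
    by (intro tendsto_add tendsto_mult tendsto_const const_over_ln
        has_log_density_positive[unfolded has_log_density_def])
  then have "\<forall>\<^sub>F N in sequentially. C / ln (real N) + e / 2 * (recip_sum ({1..} \<inter> {1..N}) / ln (real N)) < e"
    by (rule order_tendstoD) (use e in simp)
  with ln_pos_eventually
  have "\<forall>\<^sub>F N in sequentially. norm ((\<Sum>n=1..N. x n / real n) / ln (real N) - 0) < e"
  proof eventually_elim
    case (elim N)
    have "\<bar>(\<Sum>n=1..N. x n / real n) / ln (real N)\<bar> \<le> (C + e / 2 * recip_sum ({1..} \<inter> {1..N})) / ln (real N)"
      using bound[of N] elim(1) by (simp add: abs_divide divide_right_mono)
    then show ?case using elim(2) by (simp add: add_divide_distrib)
  qed
  then show "\<exists>no. \<forall>N\<ge>no. norm ((\<Sum>n=1..N. x n / real n) / ln (real N) - 0) < e"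
    by (simp add: eventually_sequentially)
qed

lemma has_density_imp_has_log_density:
  assumes "has_density R c"
  shows "has_log_density R c"
proof -
  define T where "T n = real (card (R \<inter> {1..n})) - c * real n" for n
  define x where "x n = T n / real (n + 1)" for n
  have "(\<lambda>n. (real (card (R \<inter> {1..n})) / real n - c) * (real n / real (n + 1))) \<longlonglongrightarrow> (c - c) * 1"
  proof (intro tendsto_mult tendsto_diff tendsto_const assms[unfolded has_density_iff])
    show "(\<lambda>n. real n / real (n + 1)) \<longlonglongrightarrow> 1" using LIMSEQ_n_over_Suc_n by simp
  qed
  moreover have "(real (card (R \<inter> {1..n})) / real n - c) * (real n / real (n + 1)) = x n" for n
    by (cases "n = 0") (simp_all add: x_def T_def diff_divide_distrib left_diff_distrib)
  ultimately have x0: "x \<longlonglongrightarrow> 0" by simp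
  \<comment> \<open>Summation by parts; the main term is a logarithmic average of the null sequence \<open>x\<close>.\<close>
  have abel: "recip_sum (R \<inter> {1..N}) - c * recip_sum ({1..} \<inter> {1..N}) = x N + (\<Sum>n=1..N. x n / real n)" for N
  proof (induction N)
    case (Suc N)
    have ins: "S \<inter> {1..Suc N} = (if Suc N \<in> S then insert (Suc N) (S \<inter> {1..N}) else S \<inter> {1..N})" for S
      by (auto simp: le_Suc_eq)
    have rs: "recip_sum (S \<inter> {1..Suc N}) = recip_sum (S \<inter> {1..N}) + indicator S (Suc N) / real (Suc N)" for S
      unfolding ins recip_sum_def by simp
    have cs: "T (Suc N) = T N + indicator R (Suc N) - c"
      unfolding T_def ins by (simp add: algebra_simps)
    have 1: "x (Suc N) + x (Suc N) / real (Suc N) = T (Suc N) / real (Suc N)"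
    proof -
      have "t / (M + 1) + t / (M + 1) / M = t / M" if "0 < M" "M + 1 \<noteq> 0" for t M :: real
        using that by (simp add: divide_simps) (simp add: algebra_simps)
      from this[of "real (Suc N)" "T (Suc N)"] show ?thesis unfolding x_def by simp
    qed
    have 2: "x N = T N / real (Suc N)" unfolding x_def by simp
    have "recip_sum (R \<inter> {1..Suc N}) - c * recip_sum ({1..} \<inter> {1..Suc N})
        = x N + (\<Sum>n=1..N. x n / real n) + (indicator R (Suc N) - c) / real (Suc N)"
      unfolding rs using Suc by (simp add: diff_divide_distrib algebra_simps)
    also have "\<dots> = T (Suc N) / real (Suc N) + (\<Sum>n=1..N. x n / real n)"
      unfolding 2 cs by (simp add: diff_divide_distrib add_divide_distrib)
    finally show ?case using 1 by simp
  qed (simp add: recip_sum_def x_def T_def)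
  have "(\<lambda>N. x N * (1 / ln (real N)) + (\<Sum>n=1..N. x n / real n) / ln (real N)
      + c * (recip_sum ({1..} \<inter> {1..N}) / ln (real N))) \<longlonglongrightarrow> 0 * 0 + 0 + c * 1"
    by (intro tendsto_add tendsto_mult tendsto_const const_over_ln x0 log_average_tendsto_0
        has_log_density_positive[unfolded has_log_density_def])
  moreover have "x N * (1 / ln (real N)) + (\<Sum>n=1..N. x n / real n) / ln (real N)
      + c * (recip_sum ({1..} \<inter> {1..N}) / ln (real N)) = recip_sum (R \<inter> {1..N}) / ln (real N)" for N
  proof -
    have "recip_sum (R \<inter> {1..N}) = x N + (\<Sum>n=1..N. x n / real n) + c * recip_sum ({1..} \<inter> {1..N})"
      using abel[of N] by linarith
    then show ?thesis by (simp add: add_divide_distrib)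
  qed
  ultimately show ?thesis unfolding has_log_density_def by simp
qed

section \<open>Free numbers divisible by a given number\<close>

lemma mem_free_set: "n \<in> free_set B \<longleftrightarrow> 1 \<le> n \<and> (\<forall>b\<in>B. \<not> b dvd n)"
  unfolding free_set_def mult_set_def multiples_def by (auto elim!: dvdE)

lemma mem_multiples: "1 \<le> r \<Longrightarrow> n \<in> multiples r \<longleftrightarrow> 1 \<le> n \<and> r dvd n"
  unfolding multiples_def by (auto elim!: dvdE) 

lemma multiples_eq_image: "multiples r = (*) r ` {1..}"
  unfolding multiples_def by auto

lemma free_set_Un: "free_set (A \<union> A') = free_set A \<inter> free_set A'"
  by (auto simp: mem_free_set)

lemma free_set_antimono: "A \<subseteq> A' \<Longrightarrow> free_set A' \<subseteq> free_set A"
  by (auto simp: mem_free_set subset_iff)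

definition quotient_set :: "nat set \<Rightarrow> nat \<Rightarrow> nat set" where
  "quotient_set B r = (\<lambda>b. b div gcd b r) ` B"

lemma dvd_mult_iff_div_gcd:
  fixes b r n :: nat
  assumes "1 \<le> r"
  shows "b dvd r * n \<longleftrightarrow> b div gcd b r dvd n"
proof -
  define g where "g = gcd b r"
  have g: "g \<noteq> 0" using assms by (simp add: g_def)
  obtain b' r' where br: "b = b' * g" "r = r' * g" "coprime b' r'"
    using gcd_coprime_exists[of b r] g unfolding g_def by blast
  have "b dvd r * n \<longleftrightarrow> g * b' dvd g * (r' * n)" using br by (simp add: mult_ac)
  also have "\<dots> \<longleftrightarrow> b' dvd n"
    using g br(3) by (simp add: coprime_dvd_mult_right_iff)
  also have "b' = b div g" using br(1) g by simp
  finally show ?thesis by (simp add: g_def)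
qed

lemma mult_mem_free_set: "1 \<le> r \<Longrightarrow> r * n \<in> free_set B \<longleftrightarrow> n \<in> free_set (quotient_set B r)"
  unfolding mem_free_set quotient_set_def by (simp add: dvd_mult_iff_div_gcd Suc_le_eq)

lemma free_set_Int_multiples:
  assumes "1 \<le> r"
  shows "free_set B \<inter> multiples r = (*) r ` free_set (quotient_set B r)"
proof -
  have "free_set B \<inter> multiples r = (*) r ` {n. r * n \<in> free_set B}"
    using assms by (auto simp: mem_multiples mem_free_set elim!: dvdE)
  then show ?thesis using mult_mem_free_set[OF assms] by simp
qed

lemma zero_notin_quotient_set: "0 \<notin> B \<Longrightarrow> 0 \<notin> quotient_set B r"
  unfolding quotient_set_def by (auto simp: dvd_div_eq_0_iff)

lemma quotient_set_coprime: "\<forall>b\<in>B. coprime b r \<Longrightarrow> quotient_set B r = B"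
  unfolding quotient_set_def by (auto simp: image_iff)

lemma free_set_Int_multiples_prime:
  fixes A :: "nat set"
  assumes "prime p"
  defines "A0 \<equiv> {a \<in> A. \<not> p dvd a}"
  shows "free_set A0 \<inter> multiples p = (*) p ` free_set A0"
proof -
  have "quotient_set A0 p = A0"
    by (rule quotient_set_coprime)
      (use prime_imp_coprime[OF assms(1)] in \<open>auto simp: A0_def coprime_commute\<close>)
  then show ?thesis
    using free_set_Int_multiples[of p A0] prime_ge_1_nat[OF assms(1)] by simp
qed

text \<open>A free number coprime to \<open>p\<close> only has to avoid the elements of \<open>A\<close> that are
  coprime to \<open>p\<close>, and a free number \<open>p m\<close> is free of \<open>A\<close> iff \<open>m\<close> is free of the set obtained by cancelling one
  factor \<open>p\<close> wherever possible. If \<open>p\<close> divides a positive element of a finite set \<open>A\<close>, both new sets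
  have a smaller sum of elements than \<open>A\<close>, which makes the induction for the correlation
  inequality work.\<close>

lemma free_set_prime_split:
  fixes A :: "nat set"
  assumes "prime p"
  defines "A0 \<equiv> {a \<in> A. \<not> p dvd a}"
  shows "free_set A = (free_set A0 - (*) p ` free_set A0) \<union> (*) p ` free_set (quotient_set A p)"
proof -
  have p: "1 \<le> p" using assms(1) prime_ge_1_nat by blast
  have "free_set A - multiples p = free_set A0 - multiples p"
    using p by (auto simp: mem_free_set mem_multiples A0_def) (blast intro: dvd_trans)
  then have "free_set A = (free_set A0 - free_set A0 \<inter> multiples p) \<union> free_set A \<inter> multiples p"
    by blast
  then show ?thesis
    unfolding free_set_Int_multiples_prime[OF assms(1), of A, folded A0_def]
      free_set_Int_multiples[OF p, of A] .
qed

lemma dvd_add_prod_iff: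
  fixes A :: "nat set"
  assumes "finite A" "a \<in> A"
  shows "a dvd n + \<Prod>A * k \<longleftrightarrow> a dvd n"
proof -
  have "a dvd \<Prod>A * k" using dvd_prodI[OF assms, of "\<lambda>x. x"] by simp
  then show ?thesis by (metis dvd_add_left_iff)
qed

lemma free_set_add_prod:
  assumes "finite A" "1 \<le> n"
  shows "n + \<Prod>A * k \<in> free_set A \<longleftrightarrow> n \<in> free_set A"
  using dvd_add_prod_iff[OF assms(1)] assms(2) by (auto simp: mem_free_set)

lemma finite_free_set_Int_has_density:
  assumes "finite A" "0 \<notin> A" "1 \<le> u" "\<And>n k. n + u * k \<in> S \<longleftrightarrow> n \<in> S"
  shows "\<exists>c. has_density (free_set A \<inter> S) c"
proof (rule periodic_has_density)
  show "1 \<le> \<Prod>A * u" using assms by (auto simp: Suc_le_eq prod_zero_iff intro: gr0I)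
  fix n :: nat assume "1 \<le> n"
  then show "n + \<Prod>A * u \<in> free_set A \<inter> S \<longleftrightarrow> n \<in> free_set A \<inter> S"
    using free_set_add_prod[OF assms(1)] assms(4)[of n "\<Prod>A"] by (auto simp: mult.commute)
qed

lemma finite_free_set_has_density: "finite A \<Longrightarrow> 0 \<notin> A \<Longrightarrow> \<exists>c. has_density (free_set A) c"
  using finite_free_set_Int_has_density[of A 1 UNIV] by simp

section \<open>A correlation inequality for divisor-closed sets\<close>

text \<open>Two decreasing properties with respect to divisibility, membership in \<open>E\<close> and freeness from
  \<open>A\<close>, are positively correlated. Induction on the sum of the elements of \<open>A\<close>: choose a prime \<open>p\<close>
  dividing an element of \<open>A\<close> and treat the \<open>n \<in> E\<close> coprime to \<open>p\<close> (total weight \<open>w\<close>) and the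
  multiples of \<open>p\<close> (total weight \<open>v\<close>) separately. With \<open>y0 \<ge> y1\<close> the densities of the two free sets
  from \<open>free_set_prime_split\<close>, the induction hypothesis gives \<open>w y0 + v y1\<close>, whereas
  \<open>c = (1 - 1/p) y0 + y1/p\<close>. This is at least \<open>c (w + v)\<close>, because divisor-closedness yields
  \<open>v \<le> (w + v) / p\<close>: multiples of \<open>p\<close> have no more than their proper share of the weight.\<close>

lemma finite_free_set_correlation:
  assumes "finite A" "0 \<notin> A" "has_density (free_set A) c"
    and "finite E" "0 \<notin> E" "\<And>m n. n \<in> E \<Longrightarrow> m dvd n \<Longrightarrow> m \<in> E"
  shows "c * recip_sum E \<le> recip_sum (E \<inter> free_set A)"
  using assms
proof (induction "\<Sum>A" arbitrary: A E c rule: less_induct)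
  case (less A E c)
  show ?case
  proof (cases "A \<subseteq> {1}")
    case True
    then consider "A = {}" | "A = {1}" by blast
    then show ?thesis
    proof cases
      case 1
      then have A: "free_set A = {1..}" by (auto simp: mem_free_set)
      then have "c = 1" using less.prems(3) has_density_unique has_density_positive by auto
      moreover have "E \<inter> {1..} = E" using less.prems(5) by (auto simp: Suc_le_eq intro: gr0I)
      ultimately show ?thesis using A by simp
    next
      case 2
      then have "free_set A = {}" by (auto simp: mem_free_set)
      then have "c = 0" using less.prems(3) has_density_unique has_density_empty by auto
      then show ?thesis by (simp add: recip_sum_nonneg)
    qed
  next
    case False
    then obtain a p where a: "a \<in> A" and p: "prime p" "p dvd a"
      using prime_factor_nat by blast
    have p1: "1 \<le> p" "1 < p" using p(1) prime_ge_1_nat prime_gt_1_nat by blast+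
    define A0 where "A0 = {a \<in> A. \<not> p dvd a}"
    define A1 where "A1 = quotient_set A p"
    define E0 where "E0 = {n \<in> E. \<not> p dvd n}"
    define E1 where "E1 = {n. p * n \<in> E}"
    have A0: "finite A0" "0 \<notin> A0" using less.prems(1,2) by (auto simp: A0_def)
    have A1: "finite A1" "0 \<notin> A1"
      using less.prems(1,2) zero_notin_quotient_set by (auto simp: A1_def quotient_set_def)
    have "\<Sum>A0 < \<Sum>A"
    proof (rule sum_strict_mono2[of A A0 a])
      show "0 < a" using a less.prems(2) by (auto intro: gr0I)
    qed (use less.prems(1) a p(2) in \<open>auto simp: A0_def\<close>)
    have "\<Sum>A1 \<le> (\<Sum>b\<in>A. b div gcd b p)"
      unfolding A1_def quotient_set_def
      using sum_image_le[of A "\<lambda>x. x" "\<lambda>b. b div gcd b p"] less.prems(1) by (simp add: o_def)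
    also have "\<dots> < \<Sum>A"
    proof (rule sum_strict_mono_ex1)
      have "gcd a p = p" using p(2) by (simp add: gcd_nat.absorb2)
      moreover have "0 < a" using a less.prems(2) by (auto intro: gr0I)
      ultimately show "\<exists>b\<in>A. b div gcd b p < b" using a p1
        by (intro bexI[of _ a]) simp_all
    qed (use less.prems(1) in auto)
    finally have "\<Sum>A1 < \<Sum>A" .
    obtain y0 where y0: "has_density (free_set A0) y0" using finite_free_set_has_density[OF A0] by blast
    obtain y1 where y1: "has_density (free_set A1) y1" using finite_free_set_has_density[OF A1] by blast
    have sub: "A0 \<subseteq> A1"
    proof
      fix b assume b: "b \<in> A0"
      then have "gcd b p = 1"
        using prime_imp_coprime[OF p(1), of b] by (auto simp: A0_def coprime_iff_gcd_eq_1 gcd.commute)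
      then show "b \<in> A1" using b by (force simp: A0_def A1_def quotient_set_def)
    qed
    have y: "y1 \<le> y0" using has_density_mono[OF y1 y0 free_set_antimono[OF sub]] .
    have img0: "(*) p ` free_set A0 \<subseteq> free_set A0"
      using free_set_Int_multiples_prime[OF p(1), of A] unfolding A0_def by blast
    have c: "c = y0 - y0 / p + y1 / p"
    proof (rule has_density_unique[OF less.prems(3)])
      show "has_density (free_set A) (y0 - y0 / p + y1 / p)"
        unfolding free_set_prime_split[OF p(1), of A] A0_def[symmetric] A1_def[symmetric]
      proof (rule has_density_Un)
        show "has_density (free_set A0 - (*) p ` free_set A0) (y0 - y0 / p)"
          by (rule has_density_Diff[OF has_density_scale[OF y0 p1(1)] y0 img0])
        show "has_density ((*) p ` free_set A1) (y1 / p)" by (rule has_density_scale[OF y1 p1(1)])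
        show "(free_set A0 - (*) p ` free_set A0) \<inter> (*) p ` free_set A1 = {}"
          using free_set_antimono[OF sub] by auto
      qed
    qed
    have E1sub: "E1 \<subseteq> E" using less.prems(6) by (auto simp: E1_def)
    then have finE: "finite E0" "finite E1" using less.prems(4) finite_subset by (auto simp: E0_def)
    have E: "E = E0 \<union> (*) p ` E1" unfolding E0_def E1_def by (auto elim!: dvdE)
    have disj: "E0 \<inter> (*) p ` E1 = {}" by (auto simp: E0_def)
    have EA: "E \<inter> free_set A = E0 \<inter> free_set A0 \<union> (*) p ` (E1 \<inter> free_set A1)"
    proof -
      have "E0 \<inter> free_set A = E0 \<inter> free_set A0"
        by (auto simp: E0_def A0_def mem_free_set) (blast intro: dvd_trans)
      moreover have "(*) p ` E1 \<inter> free_set A = (*) p ` (E1 \<inter> free_set A1)"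
        using mult_mem_free_set[OF p1(1), of _ A] by (auto simp: A1_def)
      ultimately show ?thesis using E by blast
    qed
    define w v where "w = recip_sum E0" and "v = recip_sum E1 / p"
    have W: "recip_sum E = w + v"
      unfolding w_def v_def recip_sum_scale[OF p1(1), symmetric]
      using recip_sum_Un[of E0 "(*) p ` E1"] E finE disj by simp
    have "recip_sum (E \<inter> free_set A) = recip_sum (E0 \<inter> free_set A0) + recip_sum ((*) p ` (E1 \<inter> free_set A1))"
      unfolding EA by (rule recip_sum_Un) (use finE disj in auto)
    also have "\<dots> = recip_sum (E0 \<inter> free_set A0) + recip_sum (E1 \<inter> free_set A1) / p"
      by (simp add: recip_sum_scale[OF p1(1)])
    also have "\<dots> \<ge> y0 * w + y1 * v"
    proof -
      have "y0 * w \<le> recip_sum (E0 \<inter> free_set A0)" unfolding w_def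
        by (rule less.hyps[OF \<open>\<Sum>A0 < \<Sum>A\<close> A0 y0])
          (use less.prems(4-6) dvd_trans[of p] in \<open>auto simp: E0_def\<close>)
      moreover have "y1 * recip_sum E1 \<le> recip_sum (E1 \<inter> free_set A1)"
      proof (rule less.hyps[OF \<open>\<Sum>A1 < \<Sum>A\<close> A1 y1 finE(2)])
        show "0 \<notin> E1" using less.prems(5) by (simp add: E1_def)
        show "m \<in> E1" if "n \<in> E1" "m dvd n" for m n
          using that less.prems(6)[of "p * n" "p * m"] by (simp add: E1_def)
      qed
      ultimately show ?thesis unfolding v_def
        by (simp add: add_mono divide_right_mono)
    qed
    finally have lower: "y0 * w + y1 * v \<le> recip_sum (E \<inter> free_set A)" .
    have "recip_sum E1 \<le> recip_sum E" using recip_sum_mono[OF less.prems(4) E1sub] .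
    then have "v \<le> recip_sum E / p" unfolding v_def by (simp add: divide_right_mono)
    then have "v \<le> (w + v) / p" unfolding W .
    then have "0 \<le> (y0 - y1) * ((w + v) / p - v)" using y by simp
    also have "\<dots> = (y0 * w + y1 * v) - c * recip_sum E"
      unfolding c W by (simp add: algebra_simps add_divide_distrib diff_divide_distrib)
    finally show ?thesis using lower by simp
  qed
qed

section \<open>The theorem of Davenport and Erdos and Behrend's inequality\<close>

text \<open>By \<open>davenport_erdos\<close> below, this is the logarithmic density of \<^term>\<open>free_set A\<close>; the infimum
  over finite subsets is the form in which lower bounds for finite truncations pass to \<open>A\<close>.\<close>

definition free_density :: "nat set \<Rightarrow> real" where
  "free_density A = Inf {c. \<exists>F\<subseteq>A. finite F \<and> has_density (free_set F) c}"

lemma free_density_le: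
  assumes "F \<subseteq> A" "finite F" "has_density (free_set F) c"
  shows "free_density A \<le> c"
  unfolding free_density_def
proof (rule cInf_lower)
  show "bdd_below {c. \<exists>F\<subseteq>A. finite F \<and> has_density (free_set F) c}"
    by (rule bdd_belowI[of _ 0]) (auto dest: has_density_nonneg)
qed (use assms in auto)

lemma free_density_approx:
  assumes "free_density A < e"
  obtains F c where "F \<subseteq> A" "finite F" "has_density (free_set F) c" "c < e"
proof -
  have "\<exists>c. has_density (free_set {}) c" using finite_free_set_has_density[of "{}"] by simp
  then have "{c. \<exists>F\<subseteq>A. finite F \<and> has_density (free_set F) c} \<noteq> {}" by blast
  from cInf_lessD[OF this assms[unfolded free_density_def]] show ?thesis using that by blast
qed

lemma free_set_correlation:
  assumes "0 \<notin> A" "finite E" "0 \<notin> E" "\<And>m n. n \<in> E \<Longrightarrow> m dvd n \<Longrightarrow> m \<in> E"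
  shows "free_density A * recip_sum E \<le> recip_sum (E \<inter> free_set A)"
proof -
  \<comment> \<open>As \<open>E\<close> contains all divisors of its elements, only the finitely many \<open>a \<in> E\<close> can exclude any.\<close>
  define F where "F = A \<inter> E"
  have F: "F \<subseteq> A" "finite F" "0 \<notin> F" using assms by (auto simp: F_def)
  obtain c where c: "has_density (free_set F) c" using finite_free_set_has_density[OF F(2,3)] by blast
  have "free_density A * recip_sum E \<le> c * recip_sum E"
    by (rule mult_right_mono[OF free_density_le[OF F(1,2) c] recip_sum_nonneg])
  also have "\<dots> \<le> recip_sum (E \<inter> free_set F)"
    by (rule finite_free_set_correlation[OF F(2,3) c assms(2-4)])
  also have "E \<inter> free_set F = E \<inter> free_set A"
    using assms(4) unfolding F_def by (intro set_eqI) (simp add: mem_free_set, blast)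
  finally show ?thesis .
qed

lemma dvd_in_atLeastAtMost:
  fixes m n N :: nat
  assumes "n \<in> {1..N}" "m dvd n"
  shows "m \<in> {1..N}"
  using assms dvd_imp_le[of m n] by (auto simp: Suc_le_eq intro: gr0I)

text \<open>The correlation inequality for \<open>E = {1..N}\<close> shows that the average up to \<open>N\<close> is never
  essentially below \<^term>\<open>free_density A\<close>. For the opposite bound, compare with a finite subset that nearly
  attains the infimum and whose free numbers have a natural density.\<close>

theorem davenport_erdos:
  assumes "0 \<notin> A"
  shows "has_log_density (free_set A) (free_density A)"
  unfolding has_log_density_def
proof (rule order_tendstoI)
  fix a assume a: "a < free_density A"
  have "(\<lambda>N. free_density A * (recip_sum ({1..} \<inter> {1..N}) / ln (real N))) \<longlonglongrightarrow> free_density A * 1"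
    by (intro tendsto_mult tendsto_const has_log_density_positive[unfolded has_log_density_def])
  then have "\<forall>\<^sub>F N in sequentially. a < free_density A * (recip_sum ({1..} \<inter> {1..N}) / ln (real N))"
    by (rule order_tendstoD) (use a in simp)
  with ln_pos_eventually show "\<forall>\<^sub>F N in sequentially. a < recip_sum (free_set A \<inter> {1..N}) / ln (real N)"
  proof eventually_elim
    case (elim N)
    have I: "{1..} \<inter> {1..N} = {1..N}" by auto
    have "free_density A * recip_sum {1..N} \<le> recip_sum (free_set A \<inter> {1..N})"
      unfolding Int_commute[of "free_set A"]
      by (rule free_set_correlation[OF assms _ _ dvd_in_atLeastAtMost]) auto
    then have "free_density A * recip_sum {1..N} / ln (real N) \<le> recip_sum (free_set A \<inter> {1..N}) / ln (real N)"
      using elim(1) by (simp add: divide_right_mono)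
    then show ?case using elim(2) unfolding I by simp
  qed
next
  fix a assume "free_density A < a"
  then obtain F c where F: "F \<subseteq> A" "finite F" "has_density (free_set F) c" "c < a"
    by (rule free_density_approx)
  have "\<forall>\<^sub>F N in sequentially. recip_sum (free_set F \<inter> {1..N}) / ln (real N) < a"
    using has_density_imp_has_log_density[OF F(3)] F(4) unfolding has_log_density_def
    by (rule order_tendstoD)
  with ln_pos_eventually show "\<forall>\<^sub>F N in sequentially. recip_sum (free_set A \<inter> {1..N}) / ln (real N) < a"
  proof eventually_elim
    case (elim N)
    have "recip_sum (free_set A \<inter> {1..N}) \<le> recip_sum (free_set F \<inter> {1..N})"
      using free_set_antimono[OF F(1)] by (intro recip_sum_mono) auto
    then have "recip_sum (free_set A \<inter> {1..N}) / ln (real N) \<le> recip_sum (free_set F \<inter> {1..N}) / ln (real N)"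
      using elim(1) by (simp add: divide_right_mono)
    then show ?case using elim(2) by simp
  qed
qed

lemma free_density_eqI: "0 \<notin> A \<Longrightarrow> has_log_density (free_set A) c \<Longrightarrow> free_density A = c"
  using davenport_erdos has_log_density_unique by blast

lemma free_density_eq: "0 \<notin> A \<Longrightarrow> has_density (free_set A) c \<Longrightarrow> free_density A = c"
  using free_density_eqI has_density_imp_has_log_density by blast

lemma free_density_mono:
  "0 \<notin> A \<Longrightarrow> 0 \<notin> A' \<Longrightarrow> free_set A \<subseteq> free_set A' \<Longrightarrow> free_density A \<le> free_density A'"
  using has_log_density_mono davenport_erdos by blast

lemma free_density_nonneg: "0 \<le> free_density A"
  unfolding free_density_def
proof (rule cInf_greatest)
  have "\<exists>c. has_density (free_set {}) c" using finite_free_set_has_density[of "{}"] by simp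
  then show "{c. \<exists>F\<subseteq>A. finite F \<and> has_density (free_set F) c} \<noteq> {}" by blast
qed (auto dest: has_density_nonneg)

lemma free_density_empty: "free_density {} = 1"
proof (rule free_density_eq)
  have "free_set {} = {1..}" by (auto simp: mem_free_set)
  then show "has_density (free_set {}) 1" using has_density_positive by simp
qed simp

lemma free_density_singleton:
  assumes "1 \<le> a"
  shows "free_density {a} = 1 - 1 / real a"
proof (rule free_density_eq)
  have "free_set {a} = {1..} - (*) a ` {1..}"
    by (simp add: free_set_def mult_set_def multiples_eq_image)
  then show "has_density (free_set {a}) (1 - 1 / real a)"
    using has_density_Diff[OF has_density_scale[OF has_density_positive assms] has_density_positive]
      assms by (auto simp: image_subset_iff Suc_le_eq)
qed (use assms in auto)

text \<open>The correlation inequality with \<open>E\<close> the initial segment of \<^term>\<open>free_set A'\<close> up to \<open>N\<close>, as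
  \<open>N\<close> tends to infinity.\<close>

lemma behrend_inequality:
  assumes "0 \<notin> A" "0 \<notin> A'"
  shows "free_density A * free_density A' \<le> free_density (A \<union> A')"
proof (rule tendsto_le)
  show "(\<lambda>N. recip_sum (free_set (A \<union> A') \<inter> {1..N}) / ln (real N)) \<longlonglongrightarrow> free_density (A \<union> A')"
    using davenport_erdos[of "A \<union> A'"] assms unfolding has_log_density_def by simp
  show "(\<lambda>N. free_density A * (recip_sum (free_set A' \<inter> {1..N}) / ln (real N)))
      \<longlonglongrightarrow> free_density A * free_density A'"
    using davenport_erdos[OF assms(2)] unfolding has_log_density_def by (intro tendsto_mult tendsto_const)
  show "\<forall>\<^sub>F N in sequentially. free_density A * (recip_sum (free_set A' \<inter> {1..N}) / ln (real N))
      \<le> recip_sum (free_set (A \<union> A') \<inter> {1..N}) / ln (real N)"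
    using ln_pos_eventually
  proof eventually_elim
    case (elim N)
    have "free_density A * recip_sum (free_set A' \<inter> {1..N}) \<le> recip_sum ((free_set A' \<inter> {1..N}) \<inter> free_set A)"
    proof (rule free_set_correlation[OF assms(1)])
      fix m n assume "n \<in> free_set A' \<inter> {1..N}" "m dvd n"
      then show "m \<in> free_set A' \<inter> {1..N}"
        using dvd_in_atLeastAtMost[of n N m] dvd_trans[of _ m n] by (auto simp: mem_free_set)
    qed auto
    also have "(free_set A' \<inter> {1..N}) \<inter> free_set A = free_set (A \<union> A') \<inter> {1..N}"
      by (auto simp: free_set_Un)
    finally show ?case using elim by (simp add: divide_right_mono)
  qed
qed simp

lemma free_density_UN_pos:
  assumes "finite D" "\<And>d. d \<in> D \<Longrightarrow> 0 \<notin> A d" "\<And>d. d \<in> D \<Longrightarrow> 0 < free_density (A d)"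
  shows "0 < free_density (\<Union>d\<in>D. A d)"
  using assms
proof (induction D)
  case (insert d D)
  have "0 < free_density (A d) * free_density (\<Union>d\<in>D. A d)" using insert by simp
  also have "\<dots> \<le> free_density (A d \<union> (\<Union>d\<in>D. A d))"
    by (rule behrend_inequality) (use insert.prems in auto)
  finally show ?case by simp
qed (simp add: free_density_empty)

section \<open>Taut sets\<close>

lemma div_dvd_div_antimono:
  fixes b d g :: nat
  assumes "d dvd g" "g dvd b" "g \<noteq> 0"
  shows "b div g dvd b div d"
proof -
  obtain k where k: "g = d * k" using assms(1) by blast
  have "b = b div d * d" using assms(1,2) dvd_trans by (metis dvd_div_mult_self)
  then have "b div d * g = b * k" using k by (metis mult.assoc)
  then show ?thesis using assms(2,3) by (simp add: div_dvd_iff_mult)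
qed

text \<open>The set of all \<open>b / d\<close> with \<open>b \<in> B\<close> and \<open>gcd(b, r) = d\<close> is the part of
  \<^term>\<open>quotient_set B r\<close> that belongs to the divisor \<open>d\<close> of \<open>r\<close>. Unlike the whole quotient set, its
  multiple by \<open>d\<close> lies in \<open>B\<close>.\<close>

lemma zero_notin_div_part:
  fixes B :: "nat set"
  shows "0 \<notin> B \<Longrightarrow> 0 \<notin> (\<lambda>b. b div d) ` {b \<in> B. gcd b r = d}"
  using zero_notin_quotient_set[of B r] by (auto simp: quotient_set_def)

text \<open>The quotient set is the union of its parts over the finitely many divisors of \<open>r\<close>. By Behrend's
  inequality a finite union of sets of positive free density has positive free density.\<close>

lemma free_density_quotient_set_zero:
  assumes "0 \<notin> B" "1 \<le> r" "free_density (quotient_set B r) = 0"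
  obtains d where "d dvd r" "free_density ((\<lambda>b. b div d) ` {b \<in> B. gcd b r = d}) = 0"
proof -
  have fin: "finite {d. d dvd r}" using assms(2) by auto
  have "quotient_set B r = (\<Union>d\<in>{d. d dvd r}. (\<lambda>b. b div d) ` {b \<in> B. gcd b r = d})"
    unfolding quotient_set_def by auto
  then have "\<not> (\<forall>d\<in>{d. d dvd r}. 0 < free_density ((\<lambda>b. b div d) ` {b \<in> B. gcd b r = d}))"
    using free_density_UN_pos[OF fin, of "\<lambda>d. (\<lambda>b. b div d) ` {b \<in> B. gcd b r = d}"]
      zero_notin_div_part[OF assms(1)] assms(3) by auto
  then obtain d where "d dvd r" "\<not> 0 < free_density ((\<lambda>b. b div d) ` {b \<in> B. gcd b r = d})"
    by blast
  then show ?thesis using that free_density_nonneg by (meson antisym not_less)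
qed

text \<open>The numbers that become free when \<open>b\<close> is removed are the multiples of \<open>b\<close> that are free of
  \<^term>\<open>B - {b}\<close>.\<close>

lemma free_density_Diff_singleton:
  assumes "0 \<notin> B" "b \<in> B"
  shows "free_density (B - {b}) - free_density B = free_density (quotient_set (B - {b}) b) / real b"
proof -
  have b: "1 \<le> b" using assms by (auto simp: Suc_le_eq intro: gr0I)
  have eq: "free_set (B - {b}) - free_set B = (*) b ` free_set (quotient_set (B - {b}) b)"
    unfolding free_set_Int_multiples[OF b, symmetric]
    using assms(2) b by (auto simp: mem_free_set mem_multiples)
  have "has_log_density (free_set (B - {b}) - free_set B) (free_density (B - {b}) - free_density B)"
    using assms(1) by (intro has_log_density_Diff davenport_erdos free_set_antimono) auto
  moreover have "has_log_density ((*) b ` free_set (quotient_set (B - {b}) b))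
      (free_density (quotient_set (B - {b}) b) / real b)"
    using assms(1) by (intro has_log_density_scale davenport_erdos zero_notin_quotient_set b) auto
  ultimately show ?thesis unfolding eq using has_log_density_unique by blast
qed

lemma log_density_mult_set:
  assumes "0 \<notin> B"
  shows "log_density (mult_set B) = 1 - free_density B"
proof (rule has_log_density_log_density)
  have "mult_set B \<subseteq> {1..}"
    using assms by (auto simp: mult_set_def multiples_def Suc_le_eq intro: gr0I)
  then have "mult_set B = {1..} - free_set B" by (auto simp: free_set_def)
  moreover have "free_set B \<subseteq> {1..}" by (auto simp: free_set_def)
  ultimately show "has_log_density (mult_set B) (1 - free_density B)"
    using has_log_density_Diff[OF davenport_erdos[OF assms] has_log_density_positive] by simp
qed

lemma taut_iff:
  assumes "0 \<notin> B"
  shows "taut B \<longleftrightarrow> (\<forall>b\<in>B. 0 < free_density (quotient_set (B - {b}) b))"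
  unfolding taut_def
proof (rule ball_cong[OF refl])
  fix b assume b: "b \<in> B"
  then have "0 < real b" using assms by (auto intro: gr0I)
  moreover have "log_density (mult_set B) - log_density (mult_set (B - {b}))
      = free_density (quotient_set (B - {b}) b) / real b"
    using free_density_Diff_singleton[OF assms b] assms by (simp add: log_density_mult_set)
  ultimately show "log_density (mult_set (B - {b})) < log_density (mult_set B)
      \<longleftrightarrow> 0 < free_density (quotient_set (B - {b}) b)"
    by (metis diff_gt_0_iff_gt zero_less_divide_iff less_asym)
qed

text \<open>Suppose that the density vanishes, and choose \<open>d\<close> and \<open>A\<close> with \<open>d A \<subseteq> B\<close> and
  \<^term>\<open>free_density A = 0\<close> as in \<open>free_density_quotient_set_zero\<close>. Since \<open>r\<close> is free, \<open>1 \<notin> A\<close>. By Behrend's inequality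
  an element \<open>a > 1\<close> can be dropped from \<open>A\<close> without making the density positive. So \<open>b = d a\<close> is
  redundant in \<open>B\<close> up to density zero, against tautness.\<close>

lemma taut_imp_free_density_quotient_set_pos:
  assumes "taut B" "0 \<notin> B" "r \<in> free_set B"
  shows "0 < free_density (quotient_set B r)"
proof (rule ccontr)
  assume "\<not> 0 < free_density (quotient_set B r)"
  then have "free_density (quotient_set B r) = 0" using free_density_nonneg by (meson antisym not_less)
  moreover have "1 \<le> r" using assms(3) by (simp add: mem_free_set)
  ultimately obtain d where d: "d dvd r" "free_density ((\<lambda>b. b div d) ` {b \<in> B. gcd b r = d}) = 0"
    using free_density_quotient_set_zero[OF assms(2)] by blast
  define C where "C = {b \<in> B. gcd b r = d}"
  define A where "A = (\<lambda>b. b div d) ` C"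
  have A0: "0 \<notin> A" unfolding A_def C_def by (rule zero_notin_div_part[OF assms(2)])
  have tA: "free_density A = 0" using d(2) by (simp add: A_def C_def)
  then have "C \<noteq> {}" using free_density_empty by (auto simp: A_def)
  then obtain b where b: "b \<in> B" "gcd b r = d" by (auto simp: C_def)
  define a where "a = b div d"
  have a: "a \<in> A" using b by (auto simp: a_def A_def C_def)
  have "d dvd b" using b(2) by auto
  then have bad: "b = d * a" by (simp add: a_def)
  have "a \<noteq> 1"
  proof
    assume "a = 1"
    then have "b dvd r" using bad d(1) by simp
    then show False using assms(3) b(1) by (simp add: mem_free_set)
  qed
  then have a1: "1 < a" using a A0 by (metis One_nat_def Suc_lessI gr0I)
  have "free_density {a} * free_density (A - {a}) \<le> free_density ({a} \<union> (A - {a}))"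
    by (rule behrend_inequality) (use A0 a1 in auto)
  also have "{a} \<union> (A - {a}) = A" using a by auto
  finally have "free_density (A - {a}) \<le> 0"
    using a1 tA by (simp add: free_density_singleton mult_le_0_iff)
  moreover have "free_density (quotient_set (B - {b}) b) \<le> free_density (A - {a})"
  proof (rule free_density_mono)
    show "0 \<notin> quotient_set (B - {b}) b" using assms(2) by (intro zero_notin_quotient_set) auto
    show "0 \<notin> A - {a}" using A0 by simp
    show "free_set (quotient_set (B - {b}) b) \<subseteq> free_set (A - {a})"
    proof
      fix n assume n: "n \<in> free_set (quotient_set (B - {b}) b)"
      have "\<not> x dvd n" if x: "x \<in> A - {a}" for x
      proof
        assume xn: "x dvd n"
        obtain b' where b': "b' \<in> B" "gcd b' r = d" "x = b' div d" using x by (auto simp: A_def C_def)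
        have "b' \<noteq> b" using x b' by (auto simp: a_def)
        have "d dvd gcd b' b" using b'(2) \<open>d dvd b\<close> by auto
        then have "b' div gcd b' b dvd b' div d"
        proof (rule div_dvd_div_antimono)
          show "gcd b' b \<noteq> 0" using assms(2) b'(1) by (metis gcd_eq_0_iff)
        qed simp
        then have "b' div gcd b' b dvd n" using xn b'(3) dvd_trans by blast
        moreover have "b' div gcd b' b \<in> quotient_set (B - {b}) b"
          using b'(1) \<open>b' \<noteq> b\<close> by (auto simp: quotient_set_def)
        ultimately show False using n by (auto simp: mem_free_set)
      qed
      then show "n \<in> free_set (A - {a})" using n by (auto simp: mem_free_set)
    qed
  qed
  moreover have "0 < free_density (quotient_set (B - {b}) b)"
    using assms(1) b(1) taut_iff[OF assms(2)] by blast
  ultimately show False by simp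
qed

text \<open>If \<open>b\<close> is redundant up to density zero, the part \<open>A\<close> belonging to some divisor \<open>d\<close> of \<open>b\<close> has
  \<^term>\<open>free_density A = 0\<close>. The witness is this \<open>d\<close>: it is free, as an element of \<open>B\<close> dividing \<open>d\<close>
  would divide both \<open>b\<close> and another element of \<open>B\<close>.\<close>

lemma not_taut_imp_free_density_quotient_set_zero:
  assumes "\<not> taut B" "0 \<notin> B" "primitive_set B"
  obtains r where "r \<in> free_set B" "free_density (quotient_set B r) = 0"
proof -
  obtain b where b: "b \<in> B" "free_density (quotient_set (B - {b}) b) = 0"
    using assms(1) taut_iff[OF assms(2)] free_density_nonneg by (meson antisym not_less)
  have b1: "1 \<le> b" using b(1) assms(2) by (auto simp: Suc_le_eq intro: gr0I)
  have B0: "0 \<notin> B - {b}" using assms(2) by simp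
  obtain d where d: "d dvd b" "free_density ((\<lambda>c. c div d) ` {c \<in> B - {b}. gcd c b = d}) = 0"
    using free_density_quotient_set_zero[OF B0 b1 b(2)] by blast
  have "{c \<in> B - {b}. gcd c b = d} \<noteq> {}"
  proof
    assume "{c \<in> B - {b}. gcd c b = d} = {}"
    then show False using d(2) free_density_empty by (simp only: image_empty)
  qed
  then obtain c where c: "c \<in> B" "c \<noteq> b" "gcd c b = d" by auto
  have free: "d \<in> free_set B"
    unfolding mem_free_set
  proof (intro conjI ballI notI)
    show "1 \<le> d" using c(3) b1 by (auto simp: Suc_le_eq)
    fix x assume x: "x \<in> B" "x dvd d"
    have "x = b" using x b(1) dvd_trans[OF x(2) d(1)] assms(3) by (auto simp: primitive_set_def)
    moreover have "x dvd c" using x(2) c(3) by auto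
    ultimately show False using c(1,2) b(1) assms(3) by (auto simp: primitive_set_def)
  qed
  have "(\<lambda>c. c div d) ` {c \<in> B - {b}. gcd c b = d} \<subseteq> quotient_set B d"
  proof
    fix x assume "x \<in> (\<lambda>c. c div d) ` {c \<in> B - {b}. gcd c b = d}"
    then obtain y where y: "y \<in> B" "gcd y b = d" "x = y div d" by auto
    then have "gcd y d = d" by (metis gcd_dvd1 gcd_nat.absorb2)
    then show "x \<in> quotient_set B d" using y by (force simp: quotient_set_def)
  qed
  then have "free_density (quotient_set B d) \<le> free_density ((\<lambda>c. c div d) ` {c \<in> B - {b}. gcd c b = d})"
    by (intro free_density_mono free_set_antimono zero_notin_quotient_set assms(2) zero_notin_div_part B0)
  then have "free_density (quotient_set B d) = 0" using d(2) free_density_nonneg by (metis antisym)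
  then show ?thesis using that free by blast
qed

section \<open>Free numbers in arithmetic progressions\<close>

text \<open>The elements of \<open>G\<close> are coprime to \<open>u\<close>, so freeness is invariant under translation by a multiple
  of \<open>\<Prod>G\<close> that is \<open>1\<close> modulo \<open>u\<close>. This translation carries the residue class \<open>0\<close>, where the free numbers
  are \<open>u\<close> times \<^term>\<open>free_set G\<close>, to the residue class \<open>1\<close>.\<close>

lemma has_density_free_set_one_mod:
  assumes "finite G" "0 \<notin> G" "\<forall>g\<in>G. coprime g u" "1 \<le> u" "has_density (free_set G) c"
  shows "has_density (free_set G \<inter> {t. [t = 1] (mod u)}) (c / real u)"
proof -
  have "coprime (\<Prod>G) u" using assms(3) by (intro prod_coprime_left) auto
  then obtain k where k: "[\<Prod>G * k = 1] (mod u)" using cong_solve_coprime_nat by auto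
  have "shift_down (free_set G \<inter> {t. [t = 1] (mod u)}) (\<Prod>G * k) = free_set G \<inter> multiples u"
  proof (intro set_eqI)
    fix n
    have "[n + \<Prod>G * k = 1] (mod u) \<longleftrightarrow> [n + \<Prod>G * k = 0 + \<Prod>G * k] (mod u)"
      using k by (metis add_0 cong_sym cong_trans)
    also have "\<dots> \<longleftrightarrow> u dvd n" by (simp only: cong_add_rcancel_nat cong_0_iff)
    finally show "n \<in> shift_down (free_set G \<inter> {t. [t = 1] (mod u)}) (\<Prod>G * k) \<longleftrightarrow> n \<in> free_set G \<inter> multiples u"
      using free_set_add_prod[OF assms(1), of n k] assms(4)
      by (cases "1 \<le> n") (auto simp: shift_down_def mem_multiples mem_free_set)
  qed
  also have "\<dots> = (*) u ` free_set G"
    unfolding free_set_Int_multiples[OF assms(4)] quotient_set_coprime[OF assms(3)] ..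
  finally show ?thesis
    using has_density_scale[OF assms(5,4)] has_density_shift_down by metis
qed

text \<open>The progression contains all \<open>r t\<close> with \<open>t \<equiv> 1 (mod u)\<close>. Such a \<open>t\<close> is coprime to \<open>u\<close>, so it is
  free of the quotient set as soon as it is free of the elements coprime to \<open>u\<close>.\<close>

lemma finite_free_set_progression:
  assumes "finite F" "0 \<notin> F" "1 \<le> r" "1 \<le> u"
  obtains e where "free_density (quotient_set F r) / (real r * real u) \<le> e"
    "has_density (free_set F \<inter> {m. [m = r] (mod u)}) e"
proof -
  define G where "G = {q \<in> quotient_set F r. coprime q u}"
  have G: "finite G" "0 \<notin> G" "\<forall>g\<in>G. coprime g u" "G \<subseteq> quotient_set F r"
    using assms(1) zero_notin_quotient_set[OF assms(2)] by (auto simp: G_def quotient_set_def)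
  obtain c where c: "has_density (free_set G) c" using finite_free_set_has_density[OF G(1,2)] by blast
  obtain e where e: "has_density (free_set F \<inter> {m. [m = r] (mod u)}) e"
    using finite_free_set_Int_has_density[OF assms(1,2,4), of "{m. [m = r] (mod u)}"]
    by (auto simp: cong_def)
  have low: "has_density ((*) r ` (free_set G \<inter> {t. [t = 1] (mod u)})) (c / real u / real r)"
    by (intro has_density_scale has_density_free_set_one_mod G c assms)
  have "(*) r ` (free_set G \<inter> {t. [t = 1] (mod u)}) \<subseteq> free_set F \<inter> {m. [m = r] (mod u)}"
  proof (intro image_subsetI IntI CollectI)
    fix t assume t: "t \<in> free_set G \<inter> {t. [t = 1] (mod u)}"
    then have t1: "[t = 1] (mod u)" by simp
    then show "[r * t = r] (mod u)" by (metis cong_scalar_left mult.right_neutral)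
    have cop: "coprime t u" using t1 by (metis cong_imp_coprime cong_sym coprime_1_left)
    have "t \<in> free_set (quotient_set F r)"
      unfolding mem_free_set
    proof (intro conjI ballI notI)
      show "1 \<le> t" using t by (simp add: mem_free_set)
      fix q assume q: "q \<in> quotient_set F r" "q dvd t"
      have "coprime q u" using cop q(2) by (metis coprime_divisors dvd_refl)
      then show False using q t by (auto simp: G_def mem_free_set)
    qed
    then show "r * t \<in> free_set F" using mult_mem_free_set[OF assms(3)] by blast
  qed
  from has_density_mono[OF low e this] have "c / real u / real r \<le> e" .
  moreover have "free_density (quotient_set F r) / (real r * real u) \<le> c / (real r * real u)"
    by (rule divide_right_mono[OF free_density_le[OF G(4,1) c]]) simp
  ultimately have "free_density (quotient_set F r) / (real r * real u) \<le> e"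
    by (simp add: divide_divide_eq_left mult.commute)
  then show ?thesis using that e by blast
qed

text \<open>If \<^term>\<open>free_set B\<close> has a natural density, it equals \<^term>\<open>free_density B\<close>. Hence the free
  sets of the truncations \<open>B \<inter> {..K}\<close> exceed \<^term>\<open>free_set B\<close> by sets of natural density tending to \<open>0\<close>,
  and intersecting with \<open>S\<close> changes nothing in this comparison.\<close>

lemma has_density_free_set_Int:
  assumes B: "0 \<notin> B" "has_density (free_set B) c"
    and fin: "\<And>F. finite F \<Longrightarrow> F \<subseteq> B \<Longrightarrow> \<exists>e\<ge>l. has_density (free_set F \<inter> S) e"
  obtains e where "l \<le> e" "has_density (free_set B \<inter> S) e"
proof -
  define F where "F K = B \<inter> {..K}" for K
  have F: "finite (F K)" "F K \<subseteq> B" "0 \<notin> F K" for K using B(1) by (auto simp: F_def)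
  obtain e where e: "\<And>K. l \<le> e K" "\<And>K. has_density (free_set (F K) \<inter> S) (e K)"
    using fin[OF F(1,2)] by metis
  obtain d where d: "\<And>K. has_density (free_set (F K)) (d K)"
    using finite_free_set_has_density[OF F(1,3)] by metis
  have sub: "free_set (F K') \<subseteq> free_set (F K)" if "K \<le> K'" for K K'
    by (rule free_set_antimono) (use that in \<open>auto simp: F_def\<close>)
  have "e K' \<le> e K" if "K \<le> K'" for K K'
    by (rule has_density_mono[OF e(2) e(2)]) (use sub[OF that] in auto)
  then have "decseq e" by (simp add: decseq_def)
  then obtain e' where e': "e \<longlonglongrightarrow> e'" using decseq_convergent[of e l] e(1) by blast
  have c: "free_density B = c" by (rule free_density_eq[OF B])
  have "has_density (free_set B \<inter> S) e'"
    unfolding has_density_iff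
  proof (rule LIMSEQ_I)
    fix x :: real assume x: "0 < x"
    have "free_density B < c + x / 4" using c x by simp
    then obtain G g where G: "G \<subseteq> B" "finite G" "has_density (free_set G) g" "g < c + x / 4"
      by (rule free_density_approx)
    obtain K0 where K0: "\<And>K. K \<ge> K0 \<Longrightarrow> \<bar>e K - e'\<bar> < x / 4"
      using LIMSEQ_D[OF e', of "x/4"] x by auto
    \<comment> \<open>So large that the truncation contains \<open>G\<close>; the inserted \<open>0\<close> covers an empty \<open>G\<close>.\<close>
    define K where "K = max K0 (Max (insert 0 G))"
    have "G \<subseteq> F K" using G(1,2) by (auto simp: F_def K_def le_max_iff_disj)
    then have dK: "d K < c + x / 4" using has_density_mono[OF d G(3) free_set_antimono] G(4) by force
    have eK: "\<bar>e K - e'\<bar> < x / 4" by (rule K0) (simp add: K_def)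
    have "has_density (free_set (F K) - free_set B) (d K - c)"
      by (rule has_density_Diff[OF B(2) d free_set_antimono[OF F(2)]])
    then have "\<forall>\<^sub>F N in sequentially. real (card ((free_set (F K) - free_set B) \<inter> {1..N})) / real N < x / 4"
      unfolding has_density_iff by (rule order_tendstoD) (use dK in simp)
    moreover have "\<forall>\<^sub>F N in sequentially. real (card ((free_set (F K) \<inter> S) \<inter> {1..N})) / real N < e K + x / 4"
      using e(2)[of K] unfolding has_density_iff by (rule order_tendstoD) (use x in simp)
    moreover have "\<forall>\<^sub>F N in sequentially. e K - x / 4 < real (card ((free_set (F K) \<inter> S) \<inter> {1..N})) / real N"
      using e(2)[of K] unfolding has_density_iff by (rule order_tendstoD) (use x in simp)
    ultimately have "\<forall>\<^sub>F N in sequentially. norm (real (card ((free_set B \<inter> S) \<inter> {1..N})) / real N - e') < x"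
    proof eventually_elim
      case (elim N)
      have "card ((free_set B \<inter> S) \<inter> {1..N}) \<le> card ((free_set (F K) \<inter> S) \<inter> {1..N})"
        using free_set_antimono[OF F(2)] by (intro card_mono) auto
      then have 1: "real (card ((free_set B \<inter> S) \<inter> {1..N})) / real N
          \<le> real (card ((free_set (F K) \<inter> S) \<inter> {1..N})) / real N"
        by (intro divide_right_mono of_nat_mono) auto
      have "card ((free_set (F K) \<inter> S) \<inter> {1..N})
          \<le> card ((free_set B \<inter> S) \<inter> {1..N} \<union> (free_set (F K) - free_set B) \<inter> {1..N})"
        by (intro card_mono) auto
      also have "\<dots> \<le> card ((free_set B \<inter> S) \<inter> {1..N}) + card ((free_set (F K) - free_set B) \<inter> {1..N})"
        by (rule card_Un_le)
      finally have "real (card ((free_set (F K) \<inter> S) \<inter> {1..N})) / real N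
          \<le> real (card ((free_set B \<inter> S) \<inter> {1..N}) + card ((free_set (F K) - free_set B) \<inter> {1..N})) / real N"
        by (intro divide_right_mono of_nat_mono) auto
      then have "real (card ((free_set (F K) \<inter> S) \<inter> {1..N})) / real N
          \<le> real (card ((free_set B \<inter> S) \<inter> {1..N})) / real N
            + real (card ((free_set (F K) - free_set B) \<inter> {1..N})) / real N"
        by (simp add: add_divide_distrib)
      then show ?case using 1 elim eK unfolding real_norm_def by linarith
    qed
    then show "\<exists>no. \<forall>N\<ge>no. norm (real (card ((free_set B \<inter> S) \<inter> {1..N})) / real N - e') < x"
      by (simp add: eventually_sequentially)
  qed
  moreover have "l \<le> e'" using LIMSEQ_le_const[OF e', of l] e(1) by blast
  ultimately show ?thesis using that by blast
qed

lemma shift_down_Int_multiples: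
  assumes "1 \<le> u"
  shows "shift_down R r \<inter> multiples u = shift_down (R \<inter> {m. [m = r] (mod u)}) r"
proof -
  have "[n + r = r] (mod u) \<longleftrightarrow> u dvd n" for n
    using cong_add_rcancel_nat[of n r 0 u] by (simp add: cong_0_iff)
  then show ?thesis
    unfolding shift_down_def by (intro set_eqI) (simp only: Int_iff mem_Collect_eq mem_multiples[OF assms], blast)
qed

lemma divisible_shift_down_free_set:
  assumes "0 \<notin> B" "has_density (free_set B) c" "1 \<le> r" "0 < free_density (quotient_set B r)"
  shows "divisible_set (shift_down (free_set B) r)"
  unfolding divisible_set_def
proof (intro allI impI)
  fix u :: nat assume u: "1 \<le> u"
  define l where "l = free_density (quotient_set B r) / (real r * real u)"
  have "\<exists>e\<ge>l. has_density (free_set F \<inter> {m. [m = r] (mod u)}) e" if F: "finite F" "F \<subseteq> B" for F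
  proof -
    have F0: "0 \<notin> F" using assms(1) F(2) by auto
    obtain e where e: "free_density (quotient_set F r) / (real r * real u) \<le> e"
      "has_density (free_set F \<inter> {m. [m = r] (mod u)}) e"
      using finite_free_set_progression[OF F(1) F0 assms(3) u] by blast
    have "quotient_set F r \<subseteq> quotient_set B r" using F(2) by (auto simp: quotient_set_def)
    then have "free_density (quotient_set B r) \<le> free_density (quotient_set F r)"
      by (intro free_density_mono free_set_antimono zero_notin_quotient_set assms(1) F0)
    then have "l \<le> free_density (quotient_set F r) / (real r * real u)"
      unfolding l_def by (simp add: divide_right_mono)
    then show ?thesis using e order_trans by blast
  qed
  then obtain e where e: "l \<le> e" "has_density (free_set B \<inter> {m. [m = r] (mod u)}) e"
    using has_density_free_set_Int[OF assms(1,2)] by blast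
  have "0 < l" using assms(3,4) u by (simp add: l_def)
  then show "\<exists>c>0. has_density (shift_down (free_set B) r \<inter> multiples u) c"
    using e unfolding shift_down_Int_multiples[OF u] has_density_shift_down by (meson less_le_trans)
qed

lemma divisible_shift_down_free_set_imp:
  assumes "0 \<notin> B" "1 \<le> r" "divisible_set (shift_down (free_set B) r)"
  shows "0 < free_density (quotient_set B r)"
proof -
  obtain c where c: "0 < c" "has_density (shift_down (free_set B) r \<inter> multiples r) c"
    using assms(2,3) by (auto simp: divisible_set_def)
  have eq: "free_set B \<inter> {m. [m = r] (mod r)} = free_set B \<inter> multiples r"
    using assms(2) by (auto simp: mem_free_set mem_multiples cong_def)
  have "has_density ((*) r ` free_set (quotient_set B r)) c"
    using c(2) unfolding shift_down_Int_multiples[OF assms(2)] has_density_shift_down eq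
      free_set_Int_multiples[OF assms(2)] .
  then have "has_log_density ((*) r ` free_set (quotient_set B r)) c"
    by (rule has_density_imp_has_log_density)
  moreover have "has_log_density ((*) r ` free_set (quotient_set B r)) (free_density (quotient_set B r) / real r)"
    by (intro has_log_density_scale davenport_erdos zero_notin_quotient_set assms(1,2))
  ultimately have "c = free_density (quotient_set B r) / real r" by (rule has_log_density_unique)
  then show ?thesis using c(1) by (simp add: zero_less_divide_iff)
qed

section \<open>Tautness and divisibility\<close>

theorem theorem2p26:
  fixes B D :: "nat set"
  assumes "B \<subseteq> {1..} - {1}"
    and "primitive_set B"
    and "besicovitch B"
    and "D \<subseteq> free_set B"
    and "has_density (free_set B - D) 0"
    and "\<And>r. 1 \<le> r \<Longrightarrow> r \<in> D \<longleftrightarrow> divisible_set (shift_down (free_set B) r)"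
    and "\<And>r. 1 \<le> r \<Longrightarrow> r \<in> D \<longleftrightarrow> averaging_set (shift_down (free_set B) r)"
  shows "D = free_set B \<longleftrightarrow> taut B"
proof -
  have B0: "0 \<notin> B" using assms(1) by auto
  obtain c where "has_density (mult_set B) c" using assms(3) by (auto simp: besicovitch_def)
  moreover have "mult_set B \<subseteq> {1..}"
    using B0 by (auto simp: mult_set_def multiples_def Suc_le_eq intro: gr0I)
  ultimately have dens: "has_density (free_set B) (1 - c)"
    unfolding free_set_def by (intro has_density_Diff has_density_positive)
  have D: "r \<in> D \<longleftrightarrow> 0 < free_density (quotient_set B r)" if "r \<in> free_set B" for r
  proof -
    have "1 \<le> r" using that by (simp add: mem_free_set)
    then show ?thesis
      using assms(6) divisible_shift_down_free_set[OF B0 dens] divisible_shift_down_free_set_imp[OF B0]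
      by blast
  qed
  show ?thesis
  proof
    assume "D = free_set B"
    then have "0 < free_density (quotient_set B r)" if "r \<in> free_set B" for r
      using D that by blast
    then show "taut B"
      using not_taut_imp_free_density_quotient_set_zero[OF _ B0 assms(2)] less_irrefl by metis
  next
    assume "taut B"
    then show "D = free_set B"
      using D taut_imp_free_density_quotient_set_pos[OF _ B0] assms(4) by blast
  qed
qed

end
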